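(* Fix $p > 4$, $n\geq1$ and let $a_1, \dots, a_n, b_1, \dots, b_n > 0$ be feasible sequences of second and $p$-th moments of symmetric random variables with log-concave tails, that is, for each $j=1,\dots,n$ there exists a symmetric random variable $X_j$ with log-concave tails satisfying $\mathbb{E}X_j^2=a_j^2$ and $\mathbb{E}|X_j|^p=b_j^p$. Then, we have \[ \inf\ \mathbb{E}\left|\sum_{j=1}^n X_j\right|^p = \mathbb{E}\left|\sum_{j=1}^n {\bf X}_j^-\right|^p \qquad \text{and} \qquad \sup\ \mathbb{E}\left|\sum_{j=1}^n X_j\right|^p = \mathbb{E}\left|\sum_{j=1}^n {\bf X}_j^+\right|^p, \] where the infimum and supremum are taken over all sequences $X=(X_1,\dots,X_n)$ of independent symmetric random variables $X_1,\dots,X_n$ with log-concave tails, $\mathbb{E} X_j^2 = a_j^2$ and $\mathbb{E}|X_j|^p = b_j^p$, and where ${\bf X}_1^-,\dots,{\bf X}_n^-$ (respectively ${\bf X}_1^+,\dots,{\bf X}_n^+$) are independent and each ${\bf X}_j^-$ (respectively ${\bf X}_j^+$) has the unique law in $\mathcal{G}^-$ (respectively $\mathcal{G}^+$) that satisfies the same constraints.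
   Context: A real-valued random variable $X$ is symmetric if $X$ and $-X$ have the same distribution. A symmetric random variable $X$ is said to have log-concave tails if $T_X(t)=\mathbb{P}(|X|>t)$ is log-concave on $[0,\infty)$, i.e. $T_X((1-\lambda)s+\lambda t)\geq T_X(s)^{1-\lambda}T_X(t)^{\lambda}$ for all $s,t\geq0$ and $\lambda\in(0,1)$. Write $t_+=\max(t,0)$, and let $\mathbf{1}_S$ denote the indicator function of a set $S$. Consider the classes of distributions of symmetric random variables \[ \mathcal{G}^- = \big\{X:\ T_X(t) = e^{-a(t-b)_+} \text{ for some } a,b\geq0 \big\} \] and \[ \mathcal{G}^+ = \big\{X:\ T_X(t) = e^{-at}\mathbf{1}_{[0,b)}(t) \text{ for some } a,b\geq0 \big\}, \] where the formulas for $T_X(t)$ hold for $t\geq0$.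
   Formalization: Log-concave tails are taken with T_X(0)=1 (no atom at 0), both for feasibility and in the inf and sup, since otherwise X_j^± may not exist and the sup claim fails; G^- and G^+ also include the limits a=∞ (two-point laws) and b=∞ (two-sided exponential laws). *)

theory Defs
  imports "HOL-Probability.Probability"
begin

text \<open>
  Distributions of real random variables are Borel probability measures on the reals
  (\<^locale>\<open>real_distribution\<close>); the law of \<open>X\<close> on \<open>M\<close> is \<open>distr M borel X\<close>.
\<close>

definition symmetric_law :: "real measure \<Rightarrow> bool" where
  "symmetric_law \<mu> \<longleftrightarrow> real_distribution \<mu> \<and> distr \<mu> borel uminus = \<mu>"

definition tail :: "real measure \<Rightarrow> real \<Rightarrow> real" where
  "tail \<mu> t = measure \<mu> {x. \<bar>x\<bar> > t}"

definition log_concave_on_nonneg :: "(real \<Rightarrow> real) \<Rightarrow> bool" where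
  "log_concave_on_nonneg T \<longleftrightarrow>
     (\<forall>s\<ge>0. \<forall>t\<ge>0. \<forall>l. 0 < l \<and> l < 1 \<longrightarrow>
        T ((1 - l) * s + l * t) \<ge> T s powr (1 - l) * T t powr l)"

text \<open>
  Log-concavity of the tail on the closed half-line does not by itself exclude an atom at \<open>0\<close>:
  with \<open>0 < c < 1\<close> the tail \<open>c * exp (- t)\<close> satisfies the inequality, and its ratio of
  \<open>p\<close>-th to second moment norm, \<open>c powr (1/p - 1/2) * Gamma (p + 1) powr (1/p) / sqrt 2\<close>,
  is unattainable by the tails \<open>exp (- a * max (t - b) 0)\<close> and
  \<open>exp (- a * t) * indicator {0..<b} t\<close> (and by their limits).  The normalisation
  \<open>tail \<mu> 0 = 1\<close>, i.e. \<open>- ln (tail \<mu>)\<close> is convex and vanishes at \<open>0\<close>, is therefore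
  made explicit.
\<close>

definition log_concave_tail_laws :: "real measure set" where
  "log_concave_tail_laws =
     {\<mu>. symmetric_law \<mu> \<and> tail \<mu> 0 = 1 \<and> log_concave_on_nonneg (tail \<mu>)}"

text \<open>
  In both classes the parameters range over \<open>[0, \<infinity>]\<close>.  The second disjunct of each definition is
  the limiting member: \<open>a = \<infinity>\<close> in the first class (the two-point laws, with the right-continuous
  version of the tail) and \<open>b = \<infinity>\<close> in the second (the two-sided exponential laws).  Without them
  no law in the class would match the extreme feasible moments, for instance those of a
  random sign in the first class.
\<close>

definition G_minus :: "real measure set" where
  "G_minus = {\<mu>. symmetric_law \<mu> \<and>
     ((\<exists>a\<ge>0. \<exists>b\<ge>0. \<forall>t\<ge>0. tail \<mu> t = exp (- a * max (t - b) 0)) \<or>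
      (\<exists>b\<ge>0. \<forall>t\<ge>0. tail \<mu> t = indicator {0..<b} t))}"

definition G_plus :: "real measure set" where
  "G_plus = {\<mu>. symmetric_law \<mu> \<and>
     ((\<exists>a\<ge>0. \<exists>b\<ge>0. \<forall>t\<ge>0. tail \<mu> t = exp (- a * t) * indicator {0..<b} t) \<or>
      (\<exists>a\<ge>0. \<forall>t\<ge>0. tail \<mu> t = exp (- a * t)))}"

text \<open>
  Moments of nonnegative quantities are \<open>[0, \<infinity>]\<close>-valued integrals, so that no convention about
  non-integrable functions enters.
\<close>

definition moment_laws :: "real \<Rightarrow> real \<Rightarrow> real \<Rightarrow> real measure set" where
  "moment_laws p \<alpha> \<beta> =
     {\<mu>. (\<integral>\<^sup>+ x. ennreal (x\<^sup>2) \<partial>\<mu>) = ennreal (\<alpha>\<^sup>2) \<and>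
         (\<integral>\<^sup>+ x. ennreal (\<bar>x\<bar> powr p) \<partial>\<mu>) = ennreal (\<beta> powr p)}"

definition independent_with_laws_in ::
    "'w measure \<Rightarrow> (nat \<Rightarrow> 'w \<Rightarrow> real) \<Rightarrow> nat \<Rightarrow> (nat \<Rightarrow> real measure set) \<Rightarrow> bool" where
  "independent_with_laws_in M X n L \<longleftrightarrow>
     prob_space M \<and> prob_space.indep_vars M (\<lambda>_. borel) X {1..n} \<and>
     (\<forall>j\<in>{1..n}. distr M borel (X j) \<in> L j)"

definition sum_moment :: "real \<Rightarrow> nat \<Rightarrow> 'w measure \<Rightarrow> (nat \<Rightarrow> 'w \<Rightarrow> real) \<Rightarrow> ennreal" where
  "sum_moment p n M X = (\<integral>\<^sup>+ \<omega>. ennreal (\<bar>\<Sum>j=1..n. X j \<omega>\<bar> powr p) \<partial>M)"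

text \<open>
  The values over which the infimum and supremum are taken.  A set cannot range over
  all types of sample points, so the sample points here are real sequences; the lemma below shows
  that sequences on any other probability space contribute no further values.
\<close>

definition sum_moment_values ::
    "real \<Rightarrow> nat \<Rightarrow> (nat \<Rightarrow> real) \<Rightarrow> (nat \<Rightarrow> real) \<Rightarrow> ennreal set" where
  "sum_moment_values p n a b =
     {sum_moment p n M X | (M :: (nat \<Rightarrow> real) measure) X.
        independent_with_laws_in M X n
          (\<lambda>j. log_concave_tail_laws \<inter> moment_laws p (a j) (b j))}"

lemma sum_moment_in_values:
  fixes M :: "'w measure"
  assumes "n \<ge> 1"
    and ind: "independent_with_laws_in M X n
      (\<lambda>j. log_concave_tail_laws \<inter> moment_laws p (a j) (b j))"
  shows "sum_moment p n M X \<in> sum_moment_values p n a b"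
proof -
  interpret prob_space M using ind by (simp add: independent_with_laws_in_def)
  define I where "I = {1..n}"
  have ne: "I \<noteq> {}" using assms(1) by (simp add: I_def)
  have iv: "indep_vars (\<lambda>_. borel) X I"
    using ind by (simp add: independent_with_laws_in_def I_def)
  have rv: "\<And>i. i \<in> I \<Longrightarrow> X i \<in> borel_measurable M"
    using iv by (simp add: indep_vars_def2)
  define P where "P = (\<Pi>\<^sub>M i\<in>I. (borel :: real measure))"
  define Y where "Y = (\<lambda>\<omega>. \<lambda>i\<in>I. X i \<omega>)"
  have Ym: "Y \<in> measurable M P"
    unfolding Y_def P_def by (intro measurable_restrict rv)
  define N where "N = distr M P Y"
  have Ps: "prob_space N" unfolding N_def by (rule prob_space_distr[OF Ym])
  have comp: "\<And>i. i \<in> I \<Longrightarrow> (\<lambda>f. f i) \<in> borel_measurable P"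
    unfolding P_def by (rule measurable_component_singleton)
  have compN: "\<And>i. i \<in> I \<Longrightarrow> (\<lambda>f. f i) \<in> borel_measurable N"
    using comp by (simp add: N_def)
  have law: "distr N borel (\<lambda>f. f i) = distr M borel (X i)" if "i \<in> I" for i
    unfolding N_def using that
    by (subst distr_distr[OF comp Ym]) (auto simp: Y_def comp_def intro!: distr_cong)
  have "N = (\<Pi>\<^sub>M i\<in>I. distr M borel (X i))"
    using iv indep_vars_iff_distr_eq_PiM'[OF ne, where M' = "\<lambda>_. borel" and X = X] rv
    unfolding N_def P_def Y_def by simp
  also have "\<dots> = (\<Pi>\<^sub>M i\<in>I. distr N borel (\<lambda>f. f i))"
    by (intro PiM_cong) (simp_all add: law)
  finally have 1: "N = (\<Pi>\<^sub>M i\<in>I. distr N borel (\<lambda>f. f i))" .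
  have "distr N P (\<lambda>f. \<lambda>i\<in>I. f i) = distr N N (\<lambda>f. f)"
  proof (rule distr_cong)
    show "sets P = sets N" by (simp add: N_def)
    fix f assume "f \<in> space N"
    then have "f \<in> extensional I"
      by (simp add: N_def P_def space_PiM PiE_def)
    then show "(\<lambda>i\<in>I. f i) = f" by (simp add: extensional_restrict)
  qed simp
  also have "\<dots> = N" by (rule distr_id)
  finally have 2: "distr N (\<Pi>\<^sub>M i\<in>I. borel) (\<lambda>f. \<lambda>i\<in>I. f i) = (\<Pi>\<^sub>M i\<in>I. distr N borel (\<lambda>f. f i))"
    using 1 by (simp add: P_def)
  have "prob_space.indep_vars N (\<lambda>_. borel) (\<lambda>i f. f i) I"
    using prob_space.indep_vars_iff_distr_eq_PiM'[OF Ps ne, where M' = "\<lambda>_. borel" and X = "\<lambda>i f. f i"]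
      compN 2 by simp
  then have "independent_with_laws_in N (\<lambda>i f. f i) n
      (\<lambda>j. log_concave_tail_laws \<inter> moment_laws p (a j) (b j))"
    using Ps ind law by (simp add: independent_with_laws_in_def I_def)
  moreover have "sum_moment p n N (\<lambda>i f. f i) = sum_moment p n M X"
  proof -
    have m: "(\<lambda>f. ennreal (\<bar>\<Sum>j=1..n. f j\<bar> powr p)) \<in> borel_measurable P"
      using comp unfolding I_def by measurable
    have m': "(\<lambda>f. ennreal (\<bar>\<Sum>j=1..n. f j\<bar> powr p)) \<in> borel_measurable (distr M P Y)"
      by (subst measurable_distr_eq1) (rule m)
    show ?thesis
      unfolding sum_moment_def N_def nn_integral_distr[OF Ym m']
      by (intro nn_integral_cong) (simp add: Y_def I_def)
  qed
  ultimately show ?thesis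
    unfolding sum_moment_values_def by (smt (verit) mem_Collect_eq)
qed

end

theory Submission
  imports Defs
begin

text \<open>
  For a symmetric law \<open>\<mu>\<close> with tail \<open>T\<close> and a fixed real \<open>y > 0\<close>, symmetry and the layer-cake formula give
  \<open>2 E|X + y|\<^sup>p = 2 y\<^sup>p + p \<integral> w T\<close> with \<open>w u = (u + y)\<^sup>q + sgn (u - y) |u - y|\<^sup>q\<close>, \<open>q = p - 1\<close>,
  while the second and \<open>p\<close>-th moments are the integrals of \<open>T\<close> against multiples of \<open>u\<close> and \<open>u\<^sup>q\<close>.
  For \<open>p > 4\<close> the quotient \<open>w u / u\<close> is a concave function of \<open>u powr (p - 2)\<close>, so it lies above a chord
  between the two end points of an interval and below it elsewhere.  Hence, if two symmetric laws have
  the same two moments and one tail exceeds the other exactly on an interval, then its \<open>E|X + y|\<^sup>p\<close> is the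
  larger one for every \<open>y\<close>, and this order is preserved by independent sums.  A log-concave tail
  exceeds the log-affine tail of the matching member of \<open>G_minus\<close> on an interval, and is exceeded
  by the matching member of \<open>G_plus\<close> on an interval.

  Tails with a single crossing and the same second moment are ordered by their \<open>p\<close>-th moments, strictly unless equal.
  This yields uniqueness within the classes, and bounds the feasible \<open>p\<close>-th moments by those of
  the random sign and the two-sided exponential law; both classes interpolate continuously between
  these two, which yields existence.
\<close>

subsection \<open>Concavity of the shifted power kernel\<close>

lemma has_real_derivative_shift:
  fixes g g' :: "real \<Rightarrow> real"
  assumes "\<And>x. (g has_real_derivative g' x) (at x)"
  shows "((\<lambda>u. g (u + c)) has_real_derivative g' (x + c)) (at x)"
  using assms[of "x + c"] by (simp add: DERIV_shift)

lemma has_real_derivative_abs: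
  assumes "(x::real) \<noteq> 0"
  shows "((\<lambda>x. \<bar>x\<bar>) has_real_derivative sgn x) (at x)"
proof -
  have "(norm has_derivative (\<lambda>h. h \<bullet> sgn x)) (at x)"
    by (rule has_derivative_norm[OF assms])
  moreover have "norm = (abs :: real \<Rightarrow> real)" by auto
  ultimately show ?thesis
    by (simp add: has_field_derivative_def mult_commute_abs)
qed

lemma has_real_derivative_abs_powr:
  fixes x r :: real
  assumes "r > 1"
  shows "((\<lambda>x. \<bar>x\<bar> powr r) has_real_derivative r * (sgn x * \<bar>x\<bar> powr (r - 1))) (at x)"
proof (cases "x = 0")
  case False
  then have "((\<lambda>x. \<bar>x\<bar>) has_real_derivative sgn x) (at x)"
    by (rule has_real_derivative_abs)
  then have "((\<lambda>x. \<bar>x\<bar> powr r) has_real_derivative (\<bar>x\<bar> powr r * (0 * ln \<bar>x\<bar> + sgn x * r / \<bar>x\<bar>))) (at x)"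
    using False by (intro DERIV_powr) auto
  then show ?thesis
    by (rule DERIV_cong) (use False in \<open>simp add: powr_diff field_simps\<close>)
next
  case True
  have "((\<lambda>h. \<bar>h\<bar> powr (r - 1) * sgn h) \<longlongrightarrow> 0) (at 0)"
  proof (rule Lim_null_comparison[where g = "\<lambda>h. \<bar>h\<bar> powr (r - 1)"])
    show "((\<lambda>h. \<bar>h\<bar> powr (r - 1)) \<longlongrightarrow> 0) (at (0::real))"
      by (rule tendsto_zero_powrI[where b="r-1"]) (use assms in \<open>auto intro!: tendsto_eq_intros\<close>)
  qed (auto intro!: always_eventually simp: abs_mult sgn_if)
  moreover have "(\<bar>0 + h\<bar> powr r - \<bar>0\<bar> powr r) / h = \<bar>h\<bar> powr (r - 1) * sgn h" for h :: real
    by (cases "h = 0") (auto simp: powr_diff sgn_if field_simps)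
  ultimately show ?thesis
    unfolding DERIV_def True by simp
qed

lemma has_real_derivative_sgn_powr:
  fixes x r :: real
  assumes "r > 1"
  shows "((\<lambda>x. sgn x * \<bar>x\<bar> powr r) has_real_derivative r * \<bar>x\<bar> powr (r - 1)) (at x)"
proof (cases "x = 0")
  case False
  have "((\<lambda>y. sgn x * \<bar>y\<bar> powr r) has_real_derivative sgn x * (r * (sgn x * \<bar>x\<bar> powr (r - 1)))) (at x)"
    by (intro DERIV_cmult has_real_derivative_abs_powr assms)
  moreover have "sgn x * (r * (sgn x * \<bar>x\<bar> powr (r - 1))) = r * \<bar>x\<bar> powr (r - 1)"
    using False by (simp add: sgn_if)
  moreover have "\<forall>\<^sub>F y in nhds x. sgn y * \<bar>y\<bar> powr r = sgn x * \<bar>y\<bar> powr r"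
  proof (cases "x > 0")
    case True
    then have "\<forall>\<^sub>F y in nhds x. y > 0"
      by (rule eventually_nhds_in_open[of "{0<..}" x, simplified])
    then show ?thesis by eventually_elim (use True in auto)
  next
    case False
    then have "x < 0" using \<open>x \<noteq> 0\<close> by simp
    then have "\<forall>\<^sub>F y in nhds x. y < 0"
      by (rule eventually_nhds_in_open[of "{..<0}" x, simplified])
    then show ?thesis by eventually_elim (use \<open>x < 0\<close> in auto)
  qed
  ultimately show ?thesis
    by (subst DERIV_cong_ev[OF refl _ refl]) auto
next
  case True
  have "((\<lambda>h. \<bar>h\<bar> powr (r - 1)) \<longlongrightarrow> 0) (at (0::real))"
    by (rule tendsto_zero_powrI[where b="r-1"]) (use assms in \<open>auto intro!: tendsto_eq_intros\<close>)
  moreover have "(sgn (0 + h) * \<bar>0 + h\<bar> powr r - sgn 0 * \<bar>0\<bar> powr r) / h = \<bar>h\<bar> powr (r - 1)" for h :: real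
    by (cases "h = 0") (auto simp: powr_diff sgn_if field_simps)
  ultimately show ?thesis
    unfolding DERIV_def True using assms by simp
qed

text \<open>The expression vanishes at \<open>A = B\<close>, and its derivative in \<open>A\<close>
  is a positive multiple of the defect in Young's inequality for \<open>A powr (r - 1) * B\<close>.
  It settles the case \<open>t < y\<close> of the second-order inequality below.\<close>

lemma powr_combination_nonneg:
  fixes A B r :: real
  assumes "r > 1" "0 \<le> B" "B \<le> A"
  shows "(r - 1) * A powr (r + 1) - (r + 1) * A powr r * B + (r + 1) * A * B powr r
           - (r - 1) * B powr (r + 1) \<ge> 0"
proof (cases "B = 0")
  case True
  then show ?thesis using assms by simp
next
  case False
  define f where "f = (\<lambda>x. (r - 1) * x powr (r + 1) - (r + 1) * x powr r * B + (r + 1) * x * B powr r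
           - (r - 1) * B powr (r + 1))"
  define f' where "f' = (\<lambda>x. (r + 1) * ((r - 1) * x powr r - r * x powr (r - 1) * B + B powr r))"
  have pos: "B > 0" using False assms by simp
  have "(f has_real_derivative f' x) (at x)" if "x \<ge> B" for x
    unfolding f_def f'_def using that pos
    by (auto intro!: derivative_eq_intros simp: powr_diff field_simps)
  moreover have "f' x \<ge> 0" if "x \<ge> B" for x
  proof -
    have x: "x > 0" using that pos by simp
    have "(x powr r) powr ((r - 1) / r) * (B powr r) powr (1 / r)
        \<le> (r - 1) / r * x powr r + 1 / r * B powr r"
      by (rule Youngs_inequality_0) (use assms x pos in \<open>auto simp: field_simps\<close>)
    then have "x powr (r - 1) * B \<le> ((r - 1) * x powr r + B powr r) / r"
    proof -
      have "r * ((r - 1) / r) = r - 1" "r * (1 / r) = 1" using assms by auto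
      then have "(x powr r) powr ((r - 1) / r) = x powr (r - 1)" "(B powr r) powr (1 / r) = B"
        using pos by (simp_all only: powr_powr powr_one)
      then show ?thesis
        using \<open>_ \<le> (r - 1) / r * x powr r + 1 / r * B powr r\<close> assms
        by (simp add: add_divide_distrib)
    qed
    then have "0 \<le> (r - 1) * x powr r - r * x powr (r - 1) * B + B powr r"
      using assms by (simp add: field_simps)
    then show ?thesis
      using assms unfolding f'_def by (intro mult_nonneg_nonneg) auto
  qed
  ultimately have "f B \<le> f A"
    by (intro DERIV_nonneg_imp_nondecreasing[OF assms(3)]) blast
  moreover have "f B = 0" unfolding f_def by (simp add: powr_add field_simps)
  ultimately show ?thesis unfolding f_def by simp
qed

text \<open>The line is the chord of \<open>f\<close> through \<open>a\<close> and \<open>b\<close>.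
  Convexity enters through the three-point inequality \<open>*\<close>, cleared of denominators,
  with \<open>v\<close> as its middle, left or right point.\<close>

lemma convex_on_chord:
  fixes f :: "real \<Rightarrow> real"
  assumes cv: "convex_on {0<..} f" and "0 < a" "a < b"
  shows "\<exists>\<alpha> \<beta>. \<forall>v>0. (a \<le> v \<and> v \<le> b \<longrightarrow> f v \<le> \<alpha> + \<beta> * v) \<and> (v \<le> a \<or> b \<le> v \<longrightarrow> \<alpha> + \<beta> * v \<le> f v)"
proof -
  have *: "f y * (z - x) \<le> f x * (z - y) + f z * (y - x)" if "0 < x" "x \<le> y" "y \<le> z" "x < z" for x y z
  proof -
    have "convex_on {x..z} f" using cv by (rule convex_on_subset) (use that in auto)
    then have "f y \<le> (f z - f x) / (z - x) * (y - x) + f x"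
      by (rule convex_onD_Icc') (use that in auto)
    then have "f y * (z - x) \<le> ((f z - f x) / (z - x) * (y - x) + f x) * (z - x)"
      using that by (intro mult_right_mono) auto
    also have "\<dots> = (f z - f x) * (y - x) + f x * (z - x)"
      using that by (simp add: field_simps)
    finally show ?thesis by (simp add: algebra_simps)
  qed
  define \<beta> where "\<beta> = (f b - f a) / (b - a)"
  define \<alpha> where "\<alpha> = f a - \<beta> * a"
  have line: "(\<alpha> + \<beta> * v) * (b - a) = f a * (b - v) + f b * (v - a)" for v
  proof -
    have "\<beta> * (b - a) = f b - f a" using assms by (simp add: \<beta>_def)
    then have "(\<alpha> + \<beta> * v) * (b - a) = f a * (b - a) + (f b - f a) * (v - a)"
      unfolding \<alpha>_def by algebra
    then show ?thesis by (simp add: algebra_simps)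
  qed
  have "(a \<le> v \<and> v \<le> b \<longrightarrow> f v * (b - a) \<le> (\<alpha> + \<beta> * v) * (b - a)) \<and>
        (v \<le> a \<or> b \<le> v \<longrightarrow> (\<alpha> + \<beta> * v) * (b - a) \<le> f v * (b - a))" if "v > 0" for v
    unfolding line using *[of a v b] *[of v a b] *[of a b v] assms that
    by (auto simp: algebra_simps)
  then show ?thesis
    using assms by (intro exI[of _ \<alpha>] exI[of _ \<beta>]) auto
qed

text \<open>
  With \<open>w = W q\<close> the left-hand side is \<open>t\<^sup>2 w'' - q t w' + q w\<close>, which has the sign of the derivative of
  \<open>(t w' - w) / t\<^sup>q\<close>.  The latter is, up to a constant, the derivative of \<open>w t / t\<close> with respect to \<open>t powr (q - 1)\<close>.
\<close>

lemma shifted_powr_second_order: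
  fixes q t y :: real
  assumes "q > 3" "t > 0" "y > 0"
  defines "W \<equiv> \<lambda>c. sgn (t + y) * \<bar>t + y\<bar> powr c + sgn (t - y) * \<bar>t - y\<bar> powr c"
    and "V \<equiv> \<lambda>c. \<bar>t + y\<bar> powr c + \<bar>t - y\<bar> powr c"
  shows "t\<^sup>2 * (q * (q - 1) * W (q - 2)) - q * t * (q * V (q - 1)) + q * W q \<le> 0"
proof -
  define r where "r = q - 2"
  have r: "r > 1" and q: "q = r + 2" using assms(1) by (auto simp: r_def)
  \<comment> \<open>\<open>t\<close> and \<open>y\<close> are half sums and half differences of
    \<open>A\<close> and \<open>B\<close>. Once all powers are reduced to \<open>A powr r\<close>
    and \<open>B powr r\<close>, the claim is a polynomial identity followed by a sign
    check.\<close>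
  define A where "A = t + y"
  define B where "B = \<bar>t - y\<bar>"
  have A: "A > 0" "B \<ge> 0" "B \<le> A" using assms by (auto simp: A_def B_def)
  have pw: "x powr (r + 1) = x * x powr r" "x powr (r + 2) = x\<^sup>2 * x powr r" if "x \<ge> 0" for x :: real
    using that r by (cases "x = 0"; simp add: powr_add power2_eq_square)+
  define a' b' where "a' = A powr r" and "b' = B powr r"
  have ab: "0 \<le> b'" "b' \<le> a'" using A r by (auto simp: a'_def b'_def powr_mono2)
  show ?thesis
  proof (cases "y \<le> t")
    case True
    have ty: "t = (A + B) / 2" "y = (A - B) / 2" using True by (auto simp: A_def B_def)
    have WV: "W c = A powr c + B powr c" "V c = A powr c + B powr c" for c
      using True A(1) by (auto simp: W_def V_def A_def B_def sgn_if)
    have "t\<^sup>2 * (q * (q - 1) * W (q - 2)) - q * t * (q * V (q - 1)) + q * W q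
      = t\<^sup>2 * ((r+2) * (r+1) * (a' + b')) - (r+2) * t * ((r+2) * (A * a' + B * b'))
        + (r+2) * (A\<^sup>2 * a' + B\<^sup>2 * b')"
    proof -
      have "q - 2 = r" "q - 1 = r + 1" by (auto simp: q)
      then show ?thesis
        using A by (simp only: WV q pw a'_def b'_def less_imp_le)
    qed
    \<comment> \<open>Both inner differences are nonnegative: the first by \<open>B \<le> A\<close>,
      the second because it reduces to \<open>B powr (r - 1) \<le> A powr (r - 1)\<close>.\<close>
    also have "\<dots> = - ((r+2) * y * ((r - 1) * (A * a' - B * b') + (r + 1) * (B * a' - A * b')) / 2)"
      unfolding ty by (simp add: field_simps power2_eq_square)
    also have "\<dots> \<le> 0"
    proof -
      have "B powr (r - 1) \<le> A powr (r - 1)"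
        using A r by (intro powr_mono2) auto
      then have "A * B * B powr (r - 1) \<le> A * B * A powr (r - 1)"
        using A by (intro mult_left_mono) auto
      moreover have "x powr r = x * x powr (r - 1)" if "x \<ge> 0" for x :: real
        using that r by (cases "x = 0") (auto simp: powr_diff)
      ultimately have "A * b' \<le> B * a'" using A by (simp add: a'_def b'_def ac_simps)
      moreover have "B * b' \<le> A * a'" using A ab by (intro mult_mono) auto
      ultimately show ?thesis using assms r by (simp add: mult_nonneg_nonneg)
    qed
    finally show ?thesis .
  next
    case False
    have ty: "t = (A - B) / 2" "y = (A + B) / 2" using False by (auto simp: A_def B_def)
    have WV: "W c = A powr c - B powr c" "V c = A powr c + B powr c" for c
      using False A(1) by (auto simp: W_def V_def A_def B_def sgn_if)
    have "t\<^sup>2 * (q * (q - 1) * W (q - 2)) - q * t * (q * V (q - 1)) + q * W q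
      = t\<^sup>2 * ((r+2) * (r+1) * (a' - b')) - (r+2) * t * ((r+2) * (A * a' + B * b'))
        + (r+2) * (A\<^sup>2 * a' - B\<^sup>2 * b')"
    proof -
      have "q - 2 = r" "q - 1 = r + 1" by (auto simp: q)
      then show ?thesis
        using A by (simp only: WV q pw a'_def b'_def less_imp_le)
    qed
    \<comment> \<open>For \<open>t < y\<close> the signs are mixed and no termwise argument applies;
      the bracket is the combination treated in \<open>powr_combination_nonneg\<close>.\<close>
    also have "\<dots> = - ((r+2) * y * ((r - 1) * (A * a') - (r + 1) * a' * B + (r + 1) * A * b' - (r - 1) * (B * b')) / 2)"
      unfolding ty by (simp add: field_simps power2_eq_square)
    also have "\<dots> \<le> 0"
      using powr_combination_nonneg[OF r A(2,3)] A assms r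
      by (simp add: a'_def b'_def pw mult_nonneg_nonneg)
    finally show ?thesis .
  qed
qed

text \<open>In the variable \<open>v = u powr (p - 2)\<close> the comparison function is
  \<open>u * (\<alpha> + \<beta> * v)\<close>. The claim thus compares \<open>w u / u\<close>, a
  concave function of \<open>v\<close>, with its chord between the images of \<open>s\<close> and
  \<open>t\<close>.\<close>

lemma shifted_powr_chord:
  fixes p y s t :: real
  assumes p: "p > 4" and y: "y > 0" and st: "0 < s" "s < t"
  defines "w \<equiv> \<lambda>u. sgn (u + y) * \<bar>u + y\<bar> powr (p - 1) + sgn (u - y) * \<bar>u - y\<bar> powr (p - 1)"
  shows "\<exists>\<alpha> \<beta>. \<forall>u>0. (s \<le> u \<and> u \<le> t \<longrightarrow> \<alpha> * u + \<beta> * u powr (p - 1) \<le> w u) \<and>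
     (u \<le> s \<or> t \<le> u \<longrightarrow> w u \<le> \<alpha> * u + \<beta> * u powr (p - 1))"
proof -
  define q where "q = p - 1"
  have q: "q > 3" using p by (simp add: q_def)
  define w1 where "w1 = (\<lambda>u. q * (\<bar>u + y\<bar> powr (q - 1) + \<bar>u - y\<bar> powr (q - 1)))"
  define w2 where "w2 = (\<lambda>u. q * (q - 1) * (sgn (u + y) * \<bar>u + y\<bar> powr (q - 2) + sgn (u - y) * \<bar>u - y\<bar> powr (q - 2)))"
  have dw: "(w has_real_derivative w1 u) (at u)" for u
  proof -
    note d = has_real_derivative_shift[OF has_real_derivative_sgn_powr, of q]
    have "w = (\<lambda>u. sgn (u + y) * \<bar>u + y\<bar> powr q + sgn (u + (-y)) * \<bar>u + (-y)\<bar> powr q)"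
      by (simp add: w_def q_def)
    moreover have "(\<dots> has_real_derivative q * \<bar>u + y\<bar> powr (q - 1) + q * \<bar>u + (-y)\<bar> powr (q - 1)) (at u)"
      using q by (intro DERIV_add d) auto
    ultimately show ?thesis by (simp add: w1_def distrib_left)
  qed
  have dw1: "(w1 has_real_derivative w2 u) (at u)" for u
  proof -
    note d = has_real_derivative_shift[OF has_real_derivative_abs_powr, of "q - 1"]
    have "w1 = (\<lambda>u. q * (\<bar>u + y\<bar> powr (q-1) + \<bar>u + (-y)\<bar> powr (q-1)))"
      by (simp add: w1_def)
    moreover have "(\<dots> has_real_derivative q * ((q-1) * (sgn (u + y) * \<bar>u + y\<bar> powr (q - 1 - 1)) + (q-1) * (sgn (u + (-y)) * \<bar>u + (-y)\<bar> powr (q - 1 - 1)))) (at u)"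
      using q by (intro DERIV_cmult DERIV_add d) auto
    ultimately show ?thesis by (simp add: w2_def algebra_simps)
  qed
  \<comment> \<open>With \<open>m = q - 1\<close>, the derivative of \<open>w u / u\<close> with
    respect to \<open>u powr m\<close> is \<open>R u / m\<close>, so concavity amounts to
    \<open>R\<close> being nonincreasing.\<close>
  define R where "R = (\<lambda>u. (u * w1 u - w u) * u powr (- q))"
  have dR: "(R has_real_derivative (u\<^sup>2 * w2 u - q * u * w1 u + q * w u) * u powr (- q - 1)) (at u)" if "u > 0" for u
  proof -
    have "(R has_real_derivative (1 * w1 u + w2 u * u - w1 u) * u powr (- q)
        + (- q * u powr (- q - 1)) * (u * w1 u - w u)) (at u)"
      unfolding R_def
      by (intro DERIV_mult DERIV_diff DERIV_ident dw dw1 has_real_derivative_powr that)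
    moreover have "u powr (- q) = u * u powr (- q - 1)"
      using that by (simp add: powr_diff)
    ultimately show ?thesis
      by (simp add: algebra_simps power2_eq_square)
  qed
  have R_anti: "R v \<le> R u" if "0 < u" "u \<le> v" for u v
  proof (rule DERIV_nonpos_imp_nonincreasing[OF that(2)])
    fix x assume "u \<le> x" "x \<le> v"
    then have x: "x > 0" using that by simp
    have "x\<^sup>2 * w2 x - q * x * w1 x + q * w x \<le> 0"
      using shifted_powr_second_order[OF q x y] by (simp add: w2_def w1_def w_def q_def)
    then have "(x\<^sup>2 * w2 x - q * x * w1 x + q * w x) * x powr (- q - 1) \<le> 0"
      by (simp add: mult_nonpos_nonneg)
    with dR[OF x] show "\<exists>y. (R has_real_derivative y) (at x) \<and> y \<le> 0" by blast
  qed
  define m where "m = p - 2"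
  have m: "m > 2" using p by (simp add: m_def)
  \<comment> \<open>\<open>f v\<close> is \<open>- w u / u\<close> at
    \<open>u = v powr (1 / m)\<close>. The minus sign makes it convex; it is undone by negating the
    chord coefficients at the end.\<close>
  define f where "f = (\<lambda>v. - (w (v powr (1 / m)) * v powr (- 1 / m)))"
  have "convex_on {0<..} f"
  proof (rule convex_on_realI)
    fix v :: real assume "v \<in> {0<..}"
    then have v: "v > 0" by simp
    define u where "u = v powr (1 / m)"
    have u: "u > 0" using v by (simp add: u_def)
    have "(f has_real_derivative - (w1 u * (1 / m * v powr (1 / m - 1)) * v powr (- 1 / m)
       + (- 1 / m) * v powr (- 1 / m - 1) * w u)) (at v)"
      unfolding f_def u_def
      by (intro DERIV_minus DERIV_mult has_real_derivative_powr v DERIV_chain2[OF dw])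
    moreover have "- (w1 u * (1 / m * v powr (1 / m - 1)) * v powr (- 1 / m)
       + (- 1 / m) * v powr (- 1 / m - 1) * w u) = - R u / m"
    proof -
      have "u powr (- q) = v powr (- 1 / m - 1)"
        using m by (simp add: u_def powr_powr q_def m_def field_simps)
      moreover have "u * v powr (- 1 / m - 1) = v powr (1 / m - 1) * v powr (- 1 / m)"
        by (simp add: u_def flip: powr_add)
      ultimately have "w1 u * (1 / m * v powr (1 / m - 1)) * v powr (- 1 / m)
         + (- 1 / m) * v powr (- 1 / m - 1) * w u
        = w1 u * (u * u powr (- q)) / m - u powr (- q) * w u / m"
        by simp
      then show ?thesis by (simp add: R_def algebra_simps diff_divide_distrib)
    qed
    ultimately show "(f has_real_derivative - R (v powr (1 / m)) / m) (at v)" by (simp add: u_def)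
  next
    fix x y :: real assume "x \<in> {0<..}" "y \<in> {0<..}" "x \<le> y"
    then show "- R (x powr (1 / m)) / m \<le> - R (y powr (1 / m)) / m"
      using m by (intro divide_right_mono le_imp_neg_le R_anti powr_mono2) auto
  qed auto
  from convex_on_chord[OF this, of "s powr m" "t powr m"]
  obtain \<alpha> \<beta> where ch: "\<And>v. v > 0 \<Longrightarrow> (s powr m \<le> v \<and> v \<le> t powr m \<longrightarrow> f v \<le> \<alpha> + \<beta> * v) \<and>
      (v \<le> s powr m \<or> t powr m \<le> v \<longrightarrow> \<alpha> + \<beta> * v \<le> f v)"
    using st m by (auto simp: powr_less_mono2)
  have "(s \<le> u \<and> u \<le> t \<longrightarrow> (- \<alpha>) * u + (- \<beta>) * u powr (p - 1) \<le> w u) \<and>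
     (u \<le> s \<or> t \<le> u \<longrightarrow> w u \<le> (- \<alpha>) * u + (- \<beta>) * u powr (p - 1))" if u: "u > 0" for u
  proof -
    have fu: "f (u powr m) * u = - w u"
      using u m by (simp add: f_def powr_powr powr_minus)
    have pu: "u powr (p - 1) = u powr m * u"
      using u by (simp add: m_def powr_diff power2_eq_square)
    have mono: "x powr m \<le> z powr m" if "x \<le> z" "0 < x" for x z
      using that m by (intro powr_mono2) auto
    have "f (u powr m) * u \<le> (\<alpha> + \<beta> * u powr m) * u" if "s \<le> u" "u \<le> t"
      using ch[of "u powr m"] u mono[of s u] mono[of u t] that st by (intro mult_right_mono) auto
    moreover have "(\<alpha> + \<beta> * u powr m) * u \<le> f (u powr m) * u" if "u \<le> s \<or> t \<le> u"
      using ch[of "u powr m"] u mono[of u s] mono[of t u] that st by (intro mult_right_mono) auto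
    ultimately show ?thesis unfolding fu pu by (auto simp: algebra_simps)
  qed
  then show ?thesis by blast
qed

subsection \<open>Moments as integrals of tails\<close>

lemma has_bochner_integral_iff_nn_integral:
  fixes f :: "'a \<Rightarrow> real"
  assumes "f \<in> borel_measurable M" "\<And>x. 0 \<le> f x" "0 \<le> c"
  shows "has_bochner_integral M f c \<longleftrightarrow> (\<integral>\<^sup>+x. ennreal (f x) \<partial>M) = ennreal c"
proof
  assume *: "has_bochner_integral M f c"
  then show "(\<integral>\<^sup>+x. ennreal (f x) \<partial>M) = ennreal c"
    using assms by (subst nn_integral_eq_integral) (auto simp: has_bochner_integral_iff)
qed (use assms in \<open>auto intro!: has_bochner_integral_nn_integral\<close>)

lemma tail_antimono:
  assumes "real_distribution \<mu>" "s \<le> t"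
  shows "tail \<mu> t \<le> tail \<mu> s"
proof -
  interpret real_distribution \<mu> by fact
  show ?thesis unfolding tail_def using assms(2) by (intro finite_measure_mono) auto
qed

lemma tail_bounds:
  assumes "real_distribution \<mu>"
  shows "0 \<le> tail \<mu> t" "tail \<mu> t \<le> 1"
proof -
  interpret real_distribution \<mu> by fact
  show "0 \<le> tail \<mu> t" "tail \<mu> t \<le> 1" unfolding tail_def by auto
qed

lemma borel_measurable_tail:
  assumes "real_distribution \<mu>"
  shows "tail \<mu> \<in> borel_measurable borel"
proof -
  have "mono (\<lambda>t. - tail \<mu> t)" using tail_antimono[OF assms] by (auto simp: mono_def)
  then have "(\<lambda>t. - tail \<mu> t) \<in> borel_measurable borel" by (rule borel_measurable_mono)
  then show ?thesis by simp
qed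

text \<open>Layer-cake formula: \<open>K \<bar>x\<bar>\<close> is the integral of \<open>k\<close>
  from 0 to \<open>\<bar>x\<bar>\<close>, and exchanging the two integrals leaves the mass of
  \<open>\<bar>x\<bar> > u\<close> as the factor of \<open>k u\<close>.\<close>

lemma nn_integral_abs_eq_tail:
  fixes K k :: "real \<Rightarrow> real"
  assumes "real_distribution \<mu>" and [measurable]: "k \<in> borel_measurable borel"
    and DK: "\<And>u. 0 \<le> u \<Longrightarrow> (K has_real_derivative k u) (at u)"
    and k: "\<And>u. 0 \<le> u \<Longrightarrow> 0 \<le> k u" and K0: "K 0 = 0"
  shows "(\<integral>\<^sup>+x. ennreal (K \<bar>x\<bar>) \<partial>\<mu>) =
    (\<integral>\<^sup>+u. ennreal (indicator {0<..} u * (k u * tail \<mu> u)) \<partial>lborel)"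
proof -
  interpret real_distribution \<mu> by fact
  interpret pair_sigma_finite lborel \<mu> by standard
  have meas[measurable]: "(\<lambda>(u, x). ennreal (k u) * (if 0 < u \<and> u < \<bar>x\<bar> then 1 else 0))
      \<in> borel_measurable (lborel \<Otimes>\<^sub>M \<mu>)"
    by measurable
  have "ennreal (K \<bar>x\<bar>) = (\<integral>\<^sup>+u. ennreal (k u) * (if 0 < u \<and> u < \<bar>x\<bar> then 1 else 0) \<partial>lborel)" for x
  proof -
    have "(\<integral>\<^sup>+u. ennreal (k u) * (if 0 < u \<and> u < \<bar>x\<bar> then 1 else 0) \<partial>lborel)
       = (\<integral>\<^sup>+u. ennreal (k u) * indicator {0..\<bar>x\<bar>} u \<partial>lborel)"
    proof (rule nn_integral_cong_AE)
      show "AE u in lborel. ennreal (k u) * (if 0 < u \<and> u < \<bar>x\<bar> then 1 else 0)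
          = ennreal (k u) * indicator {0..\<bar>x\<bar>} u"
        using AE_lborel_singleton[of 0] AE_lborel_singleton[of "\<bar>x\<bar>"]
        by eventually_elim (auto simp: indicator_def)
    qed
    also have "\<dots> = ennreal (K \<bar>x\<bar> - K 0)"
      by (rule nn_integral_FTC_Icc) (use DK k in auto)
    finally show ?thesis by (simp add: K0)
  qed
  then have "(\<integral>\<^sup>+x. ennreal (K \<bar>x\<bar>) \<partial>\<mu>)
     = (\<integral>\<^sup>+u. \<integral>\<^sup>+x. ennreal (k u) * (if 0 < u \<and> u < \<bar>x\<bar> then 1 else 0) \<partial>\<mu> \<partial>lborel)"
    using Fubini'[OF meas] by simp
  also have "\<dots> = (\<integral>\<^sup>+u. ennreal (indicator {0<..} u * (k u * tail \<mu> u)) \<partial>lborel)"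
  proof (intro nn_integral_cong)
    fix u :: real
    have "(\<integral>\<^sup>+x. ennreal (k u) * (if 0 < u \<and> u < \<bar>x\<bar> then 1 else 0) \<partial>\<mu>)
      = (\<integral>\<^sup>+x. ennreal (k u) * indicator {0<..} u * indicator {x. u < \<bar>x\<bar>} x \<partial>\<mu>)"
      by (intro nn_integral_cong) (auto simp: indicator_def)
    also have "\<dots> = ennreal (k u) * indicator {0<..} u * emeasure \<mu> {x. u < \<bar>x\<bar>}"
      by (rule nn_integral_cmult_indicator) simp
    also have "\<dots> = ennreal (indicator {0<..} u * (k u * tail \<mu> u))"
      using k[of u] by (auto simp: emeasure_eq_measure tail_def ennreal_mult indicator_def)
    finally show "(\<integral>\<^sup>+x. ennreal (k u) * (if 0 < u \<and> u < \<bar>x\<bar> then 1 else 0) \<partial>\<mu>)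
      = ennreal (indicator {0<..} u * (k u * tail \<mu> u))" .
  qed
  finally show ?thesis .
qed

text \<open>For the tail \<open>T\<close> of \<open>\<mu>\<close>, the value \<open>m\<close> is the \<open>q\<close>-th absolute moment of \<open>\<mu>\<close> divided by \<open>q\<close>.\<close>

definition has_tail_moment :: "real \<Rightarrow> (real \<Rightarrow> real) \<Rightarrow> real \<Rightarrow> bool" where
  "has_tail_moment q T m \<longleftrightarrow>
     has_bochner_integral lborel (\<lambda>u. indicator {0<..} u * (u powr (q - 1) * T u)) m"

text \<open>An equivalence, so that finite moments pass from given laws to their tails and from
  constructed tails back to laws.\<close>

lemma nn_integral_powr_eq_iff_has_tail_moment:
  assumes \<mu>: "real_distribution \<mu>" and "q > 1" "c \<ge> 0"
  shows "(\<integral>\<^sup>+x. ennreal (\<bar>x\<bar> powr q) \<partial>\<mu>) = ennreal c \<longleftrightarrow> has_tail_moment q (tail \<mu>) (c / q)"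
proof -
  note [measurable] = borel_measurable_tail[OF \<mu>]
  have "(\<integral>\<^sup>+x. ennreal (\<bar>\<bar>x\<bar>\<bar> powr q) \<partial>\<mu>)
     = (\<integral>\<^sup>+u. ennreal (indicator {0<..} u * (q * (sgn u * \<bar>u\<bar> powr (q - 1)) * tail \<mu> u)) \<partial>lborel)"
    by (rule nn_integral_abs_eq_tail[OF \<mu> _ has_real_derivative_abs_powr]) (use assms in auto)
  also have "\<dots> = (\<integral>\<^sup>+u. ennreal (q * (indicator {0<..} u * (u powr (q - 1) * tail \<mu> u))) \<partial>lborel)"
    by (intro nn_integral_cong) (auto simp: indicator_def mult.assoc)
  also have "\<dots> = ennreal c \<longleftrightarrow>
      has_bochner_integral lborel (\<lambda>u. q * (indicator {0<..} u * (u powr (q - 1) * tail \<mu> u))) c"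
    using assms tail_bounds[OF \<mu>] by (intro has_bochner_integral_iff_nn_integral[symmetric]) auto
  also have "\<dots> \<longleftrightarrow> has_tail_moment q (tail \<mu>) (c / q)"
    unfolding has_tail_moment_def
  proof
    assume "has_bochner_integral lborel (\<lambda>u. q * (indicator {0<..} u * (u powr (q - 1) * tail \<mu> u))) c"
    from has_bochner_integral_mult_right[of "1/q", OF this]
    show "has_bochner_integral lborel (\<lambda>u. indicator {0<..} u * (u powr (q - 1) * tail \<mu> u)) (c / q)"
      using assms by simp
  next
    assume "has_bochner_integral lborel (\<lambda>u. indicator {0<..} u * (u powr (q - 1) * tail \<mu> u)) (c / q)"
    from has_bochner_integral_mult_right[of q, OF this]
    show "has_bochner_integral lborel (\<lambda>u. q * (indicator {0<..} u * (u powr (q - 1) * tail \<mu> u))) c"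
      using assms by simp
  qed
  finally show ?thesis by simp
qed

lemma AE_eq_of_tail_moment_eq:
  assumes T: "has_tail_moment q T1 m" "has_tail_moment q T2 m"
    and le: "AE u in lborel. 0 < u \<longrightarrow> T1 u \<le> T2 u"
  shows "AE u in lborel. 0 < u \<longrightarrow> T1 u = T2 u"
proof -
  define f where "f = (\<lambda>u. indicator {0<..} u * (u powr (q - 1) * T2 u) - indicator {0<..} u * (u powr (q - 1) * T1 u))"
  have f: "has_bochner_integral lborel f (m - m)"
    using has_bochner_integral_diff T unfolding has_tail_moment_def f_def by blast
  have "AE u in lborel. 0 \<le> f u"
    using le by eventually_elim (auto simp: f_def indicator_def intro!: mult_left_mono)
  then have "AE u in lborel. f u = 0"
    using f integral_nonneg_eq_0_iff_AE[of lborel f] by (simp add: has_bochner_integral_iff)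
  then show ?thesis
    by eventually_elim (auto simp: f_def indicator_def)
qed

subsection \<open>Comparison of tails by their crossings\<close>

text \<open>No crossing point is named, so tails that never cross, or that coincide on stretches,
  are covered as well.\<close>

definition crosses_up :: "(real \<Rightarrow> real) \<Rightarrow> (real \<Rightarrow> real) \<Rightarrow> bool" where
  "crosses_up T1 T2 \<longleftrightarrow> (\<forall>u v. 0 < u \<and> u < v \<and> T2 u < T1 u \<longrightarrow> T2 v \<le> T1 v)"

lemma has_tail_moment_AE_unique:
  assumes "has_tail_moment q T1 m1" "has_tail_moment q T2 m2"
    and "AE u in lborel. 0 < u \<longrightarrow> T1 u = T2 u"
  shows "m1 = m2"
proof -
  have "integral\<^sup>L lborel (\<lambda>u. indicator {0<..} u * (u powr (q - 1) * T1 u)) =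
    integral\<^sup>L lborel (\<lambda>u. indicator {0<..} u * (u powr (q - 1) * T2 u))"
    using assms unfolding has_tail_moment_def has_bochner_integral_iff
    by (intro integral_cong_AE) (auto simp: indicator_def)
  then show ?thesis using assms by (simp add: has_tail_moment_def has_bochner_integral_iff)
qed

text \<open>Let \<open>c\<close> be the crossing point. Subtracting \<open>c powr (p - 2)\<close>
  times the common second moment turns the weight \<open>u powr (p - 1)\<close> into one with the
  sign of \<open>u - c\<close>. Its product with \<open>T1 - T2\<close> is nonnegative, and equal
  \<open>p\<close>-th moments force that product to vanish almost everywhere.\<close>

lemma tail_moment_mono_of_crosses_up:
  assumes p: "p > 2"
    and 2: "has_tail_moment 2 T1 m" "has_tail_moment 2 T2 m"
    and P: "has_tail_moment p T1 m1" "has_tail_moment p T2 m2"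
    and cr: "crosses_up T1 T2"
  shows "m2 \<le> m1" and "m1 = m2 \<Longrightarrow> AE u in lborel. 0 < u \<longrightarrow> T1 u = T2 u"
proof -
  define A where "A = {u. 0 < u \<and> T2 u < T1 u}"
  have "m2 \<le> m1 \<and> (m1 = m2 \<longrightarrow> (AE u in lborel. 0 < u \<longrightarrow> T1 u = T2 u))"
  proof (cases "A = {}")
    case True
    then have "AE u in lborel. 0 < u \<longrightarrow> T1 u = T2 u"
      by (intro AE_eq_of_tail_moment_eq[OF 2]) (force simp: A_def)
    with has_tail_moment_AE_unique[OF P this] show ?thesis by simp
  next
    case False
    define c where "c = Inf A"
    have bdd: "bdd_below A" by (rule bdd_belowI[of _ 0]) (auto simp: A_def)
    have c0: "c \<ge> 0" unfolding c_def using False by (intro cInf_greatest) (auto simp: A_def)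
    have below: "T1 u \<le> T2 u" if "0 < u" "u < c" for u
      using that cInf_lower[OF _ bdd, of u] by (force simp: A_def c_def)
    have above: "T2 u \<le> T1 u" if cu: "c < u" for u
    proof -
      obtain v where "v \<in> A" "v < u" using cu False bdd by (auto simp: c_def cInf_less_iff)
      then show ?thesis using cr by (auto simp: crosses_up_def A_def)
    qed
    define f where "f = (\<lambda>u. indicator {0<..} u * ((u powr (p - 1) - c powr (p - 2) * u) * (T1 u - T2 u)))"
    have "has_bochner_integral lborel (\<lambda>u. (indicator {0<..} u * (u powr (p - 1) * T1 u)
        - indicator {0<..} u * (u powr (p - 1) * T2 u))
        - c powr (p - 2) * (indicator {0<..} u * (u powr (2 - 1) * T1 u)
        - indicator {0<..} u * (u powr (2 - 1) * T2 u))) ((m1 - m2) - c powr (p - 2) * (m - m))"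
      using 2 P unfolding has_tail_moment_def
      by (intro has_bochner_integral_diff has_bochner_integral_mult_right) auto
    also have "(\<lambda>u. (indicator {0<..} u * (u powr (p - 1) * T1 u)
        - indicator {0<..} u * (u powr (p - 1) * T2 u))
        - c powr (p - 2) * (indicator {0<..} u * (u powr (2 - 1) * T1 u)
        - indicator {0<..} u * (u powr (2 - 1) * T2 u))) = f"
      by (auto simp: f_def indicator_def algebra_simps)
    finally have f: "has_bochner_integral lborel f (m1 - m2)" by simp
    have fac: "u powr (p - 1) - c powr (p - 2) * u = u * (u powr (p - 2) - c powr (p - 2))" if "u > 0" for u
      using that by (simp add: powr_diff power2_eq_square algebra_simps)
    have f0: "0 \<le> f u" for u
    proof (cases "u > 0")
      case u: True
      show ?thesis
      proof (cases "u \<le> c")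
        case True
        then have "u powr (p - 2) \<le> c powr (p - 2)" using u p by (intro powr_mono2) auto
        \<comment> \<open>At \<open>u = c\<close> the order of the tails is unknown, but the weight
          vanishes there.\<close>
        then show ?thesis using u below[of u] True
          by (cases "u = c") (auto simp: f_def fac intro!: mult_nonpos_nonpos mult_nonneg_nonpos)
      next
        case False
        then have "c powr (p - 2) \<le> u powr (p - 2)" using u p c0 by (intro powr_mono2) auto
        then show ?thesis using u above[of u] False by (auto simp: f_def fac)
      qed
    qed (simp add: f_def)
    from f have "m1 - m2 = integral\<^sup>L lborel f" by (simp add: has_bochner_integral_iff)
    moreover have "integral\<^sup>L lborel f \<ge> 0" using f0 by simp
    moreover have "AE u in lborel. 0 < u \<longrightarrow> T1 u = T2 u" if "m1 = m2"
    proof -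
      have "AE u in lborel. f u = 0"
        using f f0 that
        by (subst (asm) has_bochner_integral_iff) (auto simp: integral_nonneg_eq_0_iff_AE)
      then show ?thesis using AE_lborel_singleton[of c]
      proof eventually_elim
        case (elim u)
        have "u powr (p - 2) \<noteq> c powr (p - 2)" if "0 < u"
          using that elim(2) c0 p powr_less_mono2[of "p - 2" u c] powr_less_mono2[of "p - 2" c u]
          by (cases "u < c") auto
        then have "u powr (p - 1) \<noteq> c powr (p - 2) * u" if "0 < u"
          using fac[of u] that by auto
        then show ?case using elim by (auto simp: f_def)
      qed
    qed
    ultimately show ?thesis by auto
  qed
  then show "m2 \<le> m1" and "m1 = m2 \<Longrightarrow> AE u in lborel. 0 < u \<longrightarrow> T1 u = T2 u" by auto
qed

text \<open>The middle inequality is weak: the tails may touch in between, so the set of strict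
  excess need not itself be an interval.\<close>

definition exceeds_on_interval :: "(real \<Rightarrow> real) \<Rightarrow> (real \<Rightarrow> real) \<Rightarrow> bool" where
  "exceeds_on_interval T1 T2 \<longleftrightarrow> (\<forall>u v w. 0 < u \<and> u < v \<and> v < w \<and> T2 u < T1 u \<and> T2 w < T1 w \<longrightarrow> T2 v \<le> T1 v)"

text \<open>Let \<open>s\<close> and \<open>t\<close> be the infimum and supremum of the set where
  \<open>T1\<close> exceeds \<open>T2\<close>. The chord of \<open>h\<close> over this range
  integrates to the same value against both tails, while the product of \<open>h\<close> minus the
  chord with \<open>T1 - T2\<close> is nonnegative off \<open>s\<close> and \<open>t\<close>. In the
  degenerate cases the tails agree almost everywhere.\<close>

lemma tail_integral_mono_of_chord:
  fixes h :: "real \<Rightarrow> real"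
  assumes p: "p > 2"
    and 2: "has_tail_moment 2 T1 m" "has_tail_moment 2 T2 m"
    and P: "has_tail_moment p T1 m'" "has_tail_moment p T2 m'"
    and I: "has_bochner_integral lborel (\<lambda>u. indicator {0<..} u * (h u * T1 u)) I1"
           "has_bochner_integral lborel (\<lambda>u. indicator {0<..} u * (h u * T2 u)) I2"
    and ex: "exceeds_on_interval T1 T2"
    and chord: "\<And>s t. 0 < s \<Longrightarrow> s < t \<Longrightarrow>
      \<exists>\<alpha> \<beta>. \<forall>u>0. (s \<le> u \<and> u \<le> t \<longrightarrow> \<alpha> * u + \<beta> * u powr (p - 1) \<le> h u) \<and>
        (u \<le> s \<or> t \<le> u \<longrightarrow> h u \<le> \<alpha> * u + \<beta> * u powr (p - 1))"
  shows "I2 \<le> I1"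
proof -
  have trivial: ?thesis if ae: "AE u in lborel. 0 < u \<longrightarrow> T1 u = T2 u"
  proof -
    have "integral\<^sup>L lborel (\<lambda>u. indicator {0<..} u * (h u * T1 u)) =
      integral\<^sup>L lborel (\<lambda>u. indicator {0<..} u * (h u * T2 u))"
      using I ae by (intro integral_cong_AE) (auto simp: indicator_def has_bochner_integral_iff)
    then show ?thesis using I by (simp add: has_bochner_integral_iff)
  qed
  define A where "A = {u. 0 < u \<and> T2 u < T1 u}"
  define s t where "s = Inf A" and "t = Sup A"
  have bdd: "bdd_below A" by (rule bdd_belowI[of _ 0]) (auto simp: A_def)
  have btw: "T2 v \<le> T1 v" if "u \<in> A" "w \<in> A" "u < v" "v < w" for u v w
    using that ex by (auto simp: A_def exceeds_on_interval_def)
  consider (unbounded) "A = {} \<or> \<not> bdd_above A" | (zero) "A \<noteq> {}" "s \<le> 0"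
    | (point) "A \<noteq> {}" "bdd_above A" "s = t" | (proper) "A \<noteq> {}" "bdd_above A" "0 < s" "s < t"
    using cInf_le_cSup[of A, OF _ _ bdd] unfolding s_def t_def by fastforce
  then show ?thesis
  proof cases
    case unbounded
    \<comment> \<open>Excess, once it has begun, recurs beyond every point, so \<open>T1\<close>
      stays above \<open>T2\<close>. A single crossing with equal moments leaves only
      equality.\<close>
    have "crosses_up T1 T2"
      unfolding crosses_up_def
    proof (intro allI impI)
      fix u v assume *: "0 < u \<and> u < v \<and> T2 u < T1 u"
      then have u: "u \<in> A" by (simp add: A_def)
      then obtain w where "w \<in> A" "v < w" using unbounded by (force simp: bdd_above_def not_le)
      then show "T2 v \<le> T1 v" using btw u * by blast
    qed
    from trivial[OF tail_moment_mono_of_crosses_up(2)[OF p 2 P this refl]] show ?thesis .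
  next
    case zero
    \<comment> \<open>Excess occurs arbitrarily close to 0, so once \<open>T1\<close> has fallen
      below \<open>T2\<close> it cannot exceed it again.\<close>
    have "crosses_up T2 T1"
      unfolding crosses_up_def
    proof (intro allI impI)
      fix u v assume *: "0 < u \<and> u < v \<and> T1 u < T2 u"
      then have "Inf A < u" using zero by (simp add: s_def)
      then obtain w where "w \<in> A" "w < u" using zero(1) bdd by (auto simp: cInf_less_iff)
      then have "v \<notin> A" using btw[of w v u] * by auto
      then show "T1 v \<le> T2 v" using * by (auto simp: A_def)
    qed
    from tail_moment_mono_of_crosses_up(2)[OF p 2(2,1) P(2,1) this refl] show ?thesis
      by (intro trivial) auto
  next
    case point
    have As: "x = s" if "x \<in> A" for x
      using that cInf_lower[OF that bdd] cSup_upper[OF that point(2)] point(3) by (simp add: s_def t_def)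
    then have "AE u in lborel. 0 < u \<longrightarrow> T1 u \<le> T2 u"
      using AE_lborel_singleton[of s] by eventually_elim (use As in \<open>force simp: A_def not_less[symmetric]\<close>)
    from trivial[OF AE_eq_of_tail_moment_eq[OF 2 this]] show ?thesis .
  next
    case proper
    have out: "T1 u \<le> T2 u" if "0 < u" "u < s \<or> t < u" for u
      using that cInf_lower[OF _ bdd, of u] cSup_upper[OF _ proper(2), of u]
      by (force simp: A_def s_def t_def)
    have ins: "T2 v \<le> T1 v" if v: "s < v" "v < t" for v
    proof -
      obtain u where "u \<in> A" "u < v" using v(1) bdd proper(1) by (auto simp: s_def cInf_less_iff)
      moreover obtain w where "w \<in> A" "v < w"
        using v(2) proper(1,2) by (auto simp: t_def less_cSup_iff)
      ultimately show ?thesis using btw by blast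
    qed
    obtain \<alpha> \<beta> where ab: "\<And>u. u > 0 \<Longrightarrow> (s \<le> u \<and> u \<le> t \<longrightarrow> \<alpha> * u + \<beta> * u powr (p - 1) \<le> h u) \<and>
        (u \<le> s \<or> t \<le> u \<longrightarrow> h u \<le> \<alpha> * u + \<beta> * u powr (p - 1))"
      using chord[OF proper(3,4)] by blast
    define f where "f = (\<lambda>u. indicator {0<..} u * ((h u - \<alpha> * u - \<beta> * u powr (p - 1)) * (T1 u - T2 u)))"
    have "has_bochner_integral lborel (\<lambda>u. (indicator {0<..} u * (h u * T1 u)
        - indicator {0<..} u * (h u * T2 u))
        - \<alpha> * (indicator {0<..} u * (u powr (2 - 1) * T1 u) - indicator {0<..} u * (u powr (2 - 1) * T2 u))
        - \<beta> * (indicator {0<..} u * (u powr (p - 1) * T1 u) - indicator {0<..} u * (u powr (p - 1) * T2 u)))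
        ((I1 - I2) - \<alpha> * (m - m) - \<beta> * (m' - m'))"
      using 2 P I unfolding has_tail_moment_def
      by (intro has_bochner_integral_diff has_bochner_integral_mult_right) auto
    also have "(\<lambda>u. (indicator {0<..} u * (h u * T1 u)
        - indicator {0<..} u * (h u * T2 u))
        - \<alpha> * (indicator {0<..} u * (u powr (2 - 1) * T1 u) - indicator {0<..} u * (u powr (2 - 1) * T2 u))
        - \<beta> * (indicator {0<..} u * (u powr (p - 1) * T1 u) - indicator {0<..} u * (u powr (p - 1) * T2 u))) = f"
      by (auto simp: f_def indicator_def algebra_simps)
    finally have f: "has_bochner_integral lborel f (I1 - I2)" by simp
    have "AE u in lborel. 0 \<le> f u"
      using AE_lborel_singleton[of s] AE_lborel_singleton[of t]
    proof eventually_elim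
      case (elim u)
      show ?case
      proof (cases "0 < u")
        case True
        with elim consider "s < u" "u < t" | "u < s \<or> t < u" by force
        then show ?thesis
        proof cases
          case 1
          then show ?thesis using ab[OF True] ins[of u] True by (auto simp: f_def)
        next
          case 2
          then show ?thesis using ab[OF True] out[of u] True
            by (auto simp: f_def intro!: mult_nonpos_nonpos)
        qed
      qed (simp add: f_def)
    qed
    then have "0 \<le> integral\<^sup>L lborel f" by (rule integral_nonneg_AE)
    then show ?thesis using f by (simp add: has_bochner_integral_iff)
  qed
qed

subsection \<open>Shifted moments and independent sums\<close>

lemma symmetric_law_nn_integral_uminus:
  assumes "symmetric_law \<mu>" and [measurable]: "f \<in> borel_measurable borel"
  shows "(\<integral>\<^sup>+x. f (- x) \<partial>\<mu>) = (\<integral>\<^sup>+x. f x \<partial>\<mu>)"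
proof -
  interpret real_distribution \<mu> using assms(1) by (simp add: symmetric_law_def)
  have "(\<integral>\<^sup>+x. f x \<partial>\<mu>) = (\<integral>\<^sup>+x. f x \<partial>(distr \<mu> borel uminus))"
    using assms(1) by (simp add: symmetric_law_def)
  also have "\<dots> = (\<integral>\<^sup>+x. f (- x) \<partial>\<mu>)"
    by (rule nn_integral_distr) auto
  finally show ?thesis by simp
qed

text \<open>Averaging over \<open>x\<close> and \<open>- x\<close> replaces
  \<open>\<bar>x + y\<bar> powr p\<close> by half of \<open>H \<bar>x\<bar>\<close>. The function
  \<open>K\<close> is \<open>H\<close> minus its value at 0 and has derivative \<open>p * w\<close>,
  so the layer-cake formula applies to it.\<close>

lemma nn_integral_shifted_powr_eq_tail:
  fixes p y :: real
  assumes \<mu>: "symmetric_law \<mu>" and p: "p > 1" and y: "y \<ge> 0"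
    and mom: "has_tail_moment p (tail \<mu>) m"
  defines "w \<equiv> \<lambda>u. sgn (u + y) * \<bar>u + y\<bar> powr (p - 1) + sgn (u - y) * \<bar>u - y\<bar> powr (p - 1)"
  shows "\<exists>I\<ge>0. has_bochner_integral lborel (\<lambda>u. indicator {0<..} u * (w u * tail \<mu> u)) I \<and>
    2 * (\<integral>\<^sup>+x. ennreal (\<bar>x + y\<bar> powr p) \<partial>\<mu>) = ennreal (2 * y powr p) + ennreal (p * I)"
proof -
  interpret real_distribution \<mu> using \<mu> by (simp add: symmetric_law_def)
  have rd: "real_distribution \<mu>" by standard
  have em: "emeasure \<mu> UNIV = 1" using emeasure_space_1 by simp
  note [measurable] = borel_measurable_tail[OF rd]
  define H where "H = (\<lambda>u. \<bar>u + y\<bar> powr p + \<bar>u - y\<bar> powr p)"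
  define K where "K = (\<lambda>u. H u - 2 * y powr p)"
  have [measurable]: "H \<in> borel_measurable borel" "w \<in> borel_measurable borel"
    unfolding H_def w_def by measurable
  have DK: "(K has_real_derivative p * w u) (at u)" for u
  proof -
    have "K = (\<lambda>u. \<bar>u + y\<bar> powr p + \<bar>u + (-y)\<bar> powr p - 2 * y powr p)"
      by (simp add: K_def H_def)
    moreover have "(\<dots> has_real_derivative p * (sgn (u + y) * \<bar>u + y\<bar> powr (p - 1))
        + p * (sgn (u + (-y)) * \<bar>u + (-y)\<bar> powr (p - 1)) - 0) (at u)"
      using has_real_derivative_shift[OF has_real_derivative_abs_powr[OF p]] by (intro DERIV_diff DERIV_add DERIV_const)
    ultimately show ?thesis by (simp add: w_def distrib_left)
  qed
  have w0: "0 \<le> w u" if "u \<ge> 0" for u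
  proof (cases "u \<ge> y")
    case True
    then show ?thesis using y that by (auto simp: w_def sgn_if)
  next
    case False
    then have "\<bar>u - y\<bar> powr (p - 1) \<le> \<bar>u + y\<bar> powr (p - 1)" using p y that by (intro powr_mono2) auto
    then show ?thesis using y that False by (auto simp: w_def sgn_if)
  qed
  have K0: "K 0 = 0" using y by (simp add: K_def H_def)
  have Kn: "0 \<le> K u" if "u \<ge> 0" for u
  proof -
    have "K 0 \<le> K u" using that DK w0 p
      by (intro DERIV_nonneg_imp_nondecreasing[of 0 u K]) (auto intro!: exI[of _ "p * w _"])
    then show ?thesis by (simp add: K0)
  qed
  have eqK: "(\<integral>\<^sup>+x. ennreal (K \<bar>x\<bar>) \<partial>\<mu>) =
      (\<integral>\<^sup>+u. ennreal (indicator {0<..} u * (p * w u * tail \<mu> u)) \<partial>lborel)"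
    by (rule nn_integral_abs_eq_tail[OF rd _ DK]) (use w0 p K0 in auto)
  have "m \<ge> 0"
    using mom tail_bounds[OF rd] unfolding has_tail_moment_def
    by (auto simp: has_bochner_integral_iff intro!: integral_nonneg_AE)
  then have pm: "(\<integral>\<^sup>+x. ennreal (\<bar>x\<bar> powr p) \<partial>\<mu>) = ennreal (p * m)"
    using nn_integral_powr_eq_iff_has_tail_moment[OF rd p, of "p * m"] mom p by simp
  have HH: "H \<bar>x\<bar> = \<bar>x + y\<bar> powr p + \<bar>- x + y\<bar> powr p" for x
    by (cases "x \<ge> 0") (auto simp: H_def abs_minus_commute add.commute)
  \<comment> \<open>Finiteness follows from that of the \<open>p\<close>-th moment through
    \<open>\<bar>x\<bar> + y \<le> 2 * max y \<bar>x\<bar>\<close>; it is what makes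
    \<open>I\<close> a real number.\<close>
  have "(\<integral>\<^sup>+x. ennreal (K \<bar>x\<bar>) \<partial>\<mu>) < \<infinity>"
  proof -
    have bound: "ennreal (K \<bar>x\<bar>) \<le> ennreal (2 * 2 powr p) * (ennreal (y powr p) + ennreal (\<bar>x\<bar> powr p))" for x
    proof -
      have *: "z powr p \<le> 2 powr p * (y powr p + \<bar>x\<bar> powr p)" if z: "0 \<le> z" "z \<le> \<bar>x\<bar> + y" for z
      proof -
        have "z powr p \<le> (2 * max y \<bar>x\<bar>) powr p" using z p y by (intro powr_mono2) auto
        also have "\<dots> = 2 powr p * (max y \<bar>x\<bar>) powr p" using y by (simp add: powr_mult)
        also have "\<dots> \<le> 2 powr p * (y powr p + \<bar>x\<bar> powr p)"
          by (intro mult_left_mono) (auto simp: max_def)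
        finally show ?thesis .
      qed
      have "K \<bar>x\<bar> \<le> H \<bar>x\<bar>" by (simp add: K_def)
      also have "\<dots> \<le> 2 * 2 powr p * (y powr p + \<bar>x\<bar> powr p)"
      proof -
        have "\<bar>\<bar>x\<bar> - y\<bar> \<le> \<bar>x\<bar> + y" using y by (cases "\<bar>x\<bar> \<ge> y") auto
        then show ?thesis
          unfolding H_def using *[of "\<bar>\<bar>x\<bar> + y\<bar>"] *[of "\<bar>\<bar>x\<bar> - y\<bar>"] y by simp
      qed
      finally show ?thesis by (simp flip: ennreal_plus ennreal_mult)
    qed
    have "(\<integral>\<^sup>+x. ennreal (K \<bar>x\<bar>) \<partial>\<mu>) \<le>
        (\<integral>\<^sup>+x. ennreal (2 * 2 powr p) * (ennreal (y powr p) + ennreal (\<bar>x\<bar> powr p)) \<partial>\<mu>)"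
      by (intro nn_integral_mono bound)
    also have "\<dots> = ennreal (2 * 2 powr p) * (ennreal (y powr p) + ennreal (p * m))"
      by (simp add: nn_integral_cmult nn_integral_add pm em)
    also have "\<dots> < \<infinity>" by (simp add: ennreal_mult_less_top)
    finally show ?thesis .
  qed
  then obtain J where J: "J \<ge> 0" "(\<integral>\<^sup>+x. ennreal (K \<bar>x\<bar>) \<partial>\<mu>) = ennreal J"
    by (cases "\<integral>\<^sup>+x. ennreal (K \<bar>x\<bar>) \<partial>\<mu>") auto
  have "has_bochner_integral lborel (\<lambda>u. indicator {0<..} u * (p * w u * tail \<mu> u)) J"
  proof (subst has_bochner_integral_iff_nn_integral)
    show "0 \<le> indicator {0<..} u * (p * w u * tail \<mu> u)" for u
      using w0[of u] p tail_bounds[OF rd, of u] by (auto simp: indicator_def)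
  qed (use J eqK in auto)
  from has_bochner_integral_mult_right[of "1 / p", OF this]
  have "has_bochner_integral lborel (\<lambda>u. indicator {0<..} u * (w u * tail \<mu> u)) (J / p)"
    using p by (simp add: mult.assoc mult.left_commute[of "1/p"])
  moreover have "2 * (\<integral>\<^sup>+x. ennreal (\<bar>x + y\<bar> powr p) \<partial>\<mu>) = ennreal (2 * y powr p) + ennreal (p * (J / p))"
  proof -
    have "2 * (\<integral>\<^sup>+x. ennreal (\<bar>x + y\<bar> powr p) \<partial>\<mu>)
      = (\<integral>\<^sup>+x. ennreal (\<bar>x + y\<bar> powr p) \<partial>\<mu>) + (\<integral>\<^sup>+x. ennreal (\<bar>- x + y\<bar> powr p) \<partial>\<mu>)"
      using symmetric_law_nn_integral_uminus[OF \<mu>, of "\<lambda>x. ennreal (\<bar>x + y\<bar> powr p)"]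
      by (simp add: mult_2)
    also have "\<dots> = (\<integral>\<^sup>+x. ennreal (H \<bar>x\<bar>) \<partial>\<mu>)"
      unfolding HH by (subst nn_integral_add[symmetric]) auto
    also have "\<dots> = (\<integral>\<^sup>+x. ennreal (2 * y powr p) + ennreal (K \<bar>x\<bar>) \<partial>\<mu>)"
      using Kn by (intro nn_integral_cong) (auto simp: K_def simp flip: ennreal_plus)
    also have "\<dots> = ennreal (2 * y powr p) + ennreal J"
      using J by (subst nn_integral_add) (auto simp: K_def em)
    finally show ?thesis using p by simp
  qed
  ultimately show ?thesis using J p by (intro exI[of _ "J / p"]) auto
qed

lemma shifted_moment_mono:
  fixes p z :: real
  assumes p: "p > 4" and \<mu>: "symmetric_law \<mu>" and \<nu>: "symmetric_law \<nu>"
    and 2: "has_tail_moment 2 (tail \<mu>) m" "has_tail_moment 2 (tail \<nu>) m"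
    and P: "has_tail_moment p (tail \<mu>) m'" "has_tail_moment p (tail \<nu>) m'"
    and ex: "exceeds_on_interval (tail \<mu>) (tail \<nu>)"
  shows "(\<integral>\<^sup>+x. ennreal (\<bar>z + x\<bar> powr p) \<partial>\<nu>) \<le> (\<integral>\<^sup>+x. ennreal (\<bar>z + x\<bar> powr p) \<partial>\<mu>)"
proof -
  \<comment> \<open>By symmetry only the absolute value of the shift matters, so nonnegative shifts
    suffice.\<close>
  have red: "(\<integral>\<^sup>+x. ennreal (\<bar>z + x\<bar> powr p) \<partial>\<kappa>) = (\<integral>\<^sup>+x. ennreal (\<bar>x + \<bar>z\<bar>\<bar> powr p) \<partial>\<kappa>)"
    if "symmetric_law \<kappa>" for \<kappa>
  proof (cases "z \<ge> 0")
    case False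
    have "(\<integral>\<^sup>+x. ennreal (\<bar>x + \<bar>z\<bar>\<bar> powr p) \<partial>\<kappa>) = (\<integral>\<^sup>+x. ennreal (\<bar>- x + \<bar>z\<bar>\<bar> powr p) \<partial>\<kappa>)"
      using symmetric_law_nn_integral_uminus[OF that, of "\<lambda>x. ennreal (\<bar>x + \<bar>z\<bar>\<bar> powr p)"] by simp
    also have "(\<lambda>x. \<bar>- x + \<bar>z\<bar>\<bar>) = (\<lambda>x. \<bar>z + x\<bar>)" using False by (auto simp: fun_eq_iff)
    finally show ?thesis by simp
  qed (simp add: add.commute)
  define y where "y = \<bar>z\<bar>"
  have y: "y \<ge> 0" by (simp add: y_def)
  define w where "w = (\<lambda>u. sgn (u + y) * \<bar>u + y\<bar> powr (p - 1) + sgn (u - y) * \<bar>u - y\<bar> powr (p - 1))"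
  have p1: "p > 1" using p by simp
  obtain I1 where I1: "I1 \<ge> 0" "has_bochner_integral lborel (\<lambda>u. indicator {0<..} u * (w u * tail \<mu> u)) I1"
    "2 * (\<integral>\<^sup>+x. ennreal (\<bar>x + y\<bar> powr p) \<partial>\<mu>) = ennreal (2 * y powr p) + ennreal (p * I1)"
    using nn_integral_shifted_powr_eq_tail[OF \<mu> p1 y P(1)] unfolding w_def by blast
  obtain I2 where I2: "I2 \<ge> 0" "has_bochner_integral lborel (\<lambda>u. indicator {0<..} u * (w u * tail \<nu> u)) I2"
    "2 * (\<integral>\<^sup>+x. ennreal (\<bar>x + y\<bar> powr p) \<partial>\<nu>) = ennreal (2 * y powr p) + ennreal (p * I2)"
    using nn_integral_shifted_powr_eq_tail[OF \<nu> p1 y P(2)] unfolding w_def by blast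
  have "I2 \<le> I1"
  proof (rule tail_integral_mono_of_chord[OF _ 2 P I1(2) I2(2) ex])
    fix s t :: real assume st: "0 < s" "s < t"
    show "\<exists>\<alpha> \<beta>. \<forall>u>0. (s \<le> u \<and> u \<le> t \<longrightarrow> \<alpha> * u + \<beta> * u powr (p - 1) \<le> w u) \<and>
        (u \<le> s \<or> t \<le> u \<longrightarrow> w u \<le> \<alpha> * u + \<beta> * u powr (p - 1))"
    proof (cases "y = 0")
      case True
      \<comment> \<open>Without a shift, \<open>w u = 2 * u powr (p - 1)\<close> is already of the
        comparison form.\<close>
      then show ?thesis
        by (intro exI[of _ 0] exI[of _ 2]) (auto simp: w_def)
    next
      case False
      then show ?thesis unfolding w_def by (intro shifted_powr_chord p st) (use y in auto)
    qed
  qed (use p in auto)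
  then have "2 * (\<integral>\<^sup>+x. ennreal (\<bar>x + y\<bar> powr p) \<partial>\<nu>) \<le> 2 * (\<integral>\<^sup>+x. ennreal (\<bar>x + y\<bar> powr p) \<partial>\<mu>)"
    unfolding I1(3) I2(3) using p I2(1) by (intro add_left_mono ennreal_leI mult_left_mono) auto
  then show ?thesis
    unfolding red[OF \<mu>] red[OF \<nu>] y_def[symmetric]
    by (subst (asm) ennreal_mult_le_mult_iff) auto
qed

text \<open>Coordinates are replaced by induction. With the others fixed, their sum is just a shift,
  which is why the hypothesis has to hold for every \<open>z\<close>. The induction hypothesis is
  used at shift \<open>z + y\<close>; after the integrals are exchanged, coordinate \<open>i\<close>
  is replaced at the shift given by the remaining sum.\<close>

lemma PiM_shifted_moment_mono:
  fixes \<mu> \<nu> :: "'i \<Rightarrow> real measure"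
  assumes "finite I"
    and \<mu>: "\<And>i. real_distribution (\<mu> i)" and \<nu>: "\<And>i. real_distribution (\<nu> i)"
    and le: "\<And>i z. i \<in> I \<Longrightarrow>
      (\<integral>\<^sup>+x. ennreal (\<bar>z + x\<bar> powr p) \<partial>\<nu> i) \<le> (\<integral>\<^sup>+x. ennreal (\<bar>z + x\<bar> powr p) \<partial>\<mu> i)"
  shows "(\<integral>\<^sup>+x. ennreal (\<bar>z + (\<Sum>i\<in>I. x i)\<bar> powr p) \<partial>PiM I \<nu>)
    \<le> (\<integral>\<^sup>+x. ennreal (\<bar>z + (\<Sum>i\<in>I. x i)\<bar> powr p) \<partial>PiM I \<mu>)"
  using assms(1) le
proof (induction I arbitrary: z rule: finite_induct)
  case empty
  show ?case by (simp add: PiM_empty)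
next
  case (insert i I)
  interpret M: product_sigma_finite \<mu>
    using \<mu> by (auto simp: product_sigma_finite_def real_distribution_def prob_space_imp_sigma_finite)
  interpret N: product_sigma_finite \<nu>
    using \<nu> by (auto simp: product_sigma_finite_def real_distribution_def prob_space_imp_sigma_finite)
  have sets: "sets (\<mu> i) = sets borel" "sets (\<nu> i) = sets borel" for i
    using \<mu>[of i] \<nu>[of i] by (auto simp: real_distribution_def real_distribution_axioms_def)
  have meas: "(\<lambda>x. ennreal (\<bar>z + (\<Sum>j\<in>J. x j)\<bar> powr p)) \<in> borel_measurable (PiM J \<kappa>)"
    if "\<And>i. sets (\<kappa> i) = sets borel" for J :: "'i set" and \<kappa> :: "'i \<Rightarrow> real measure"
  proof -
    have "(\<lambda>x. x j) \<in> borel_measurable (PiM J \<kappa>)" if j: "j \<in> J" for j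
      using measurable_component_singleton[OF j, of \<kappa>] \<open>\<And>i. sets (\<kappa> i) = sets borel\<close>
      by (simp cong: measurable_cong_sets)
    then have [measurable]: "(\<lambda>x. \<Sum>j\<in>J. x j) \<in> borel_measurable (PiM J \<kappa>)"
      by (intro borel_measurable_sum)
    show ?thesis by measurable
  qed
  have upd: "(\<Sum>j\<in>insert i I. (x(i := y)) j) = y + (\<Sum>j\<in>I. x j)" for x :: "'i \<Rightarrow> real" and y
  proof -
    have "(\<Sum>j\<in>I. (x(i := y)) j) = (\<Sum>j\<in>I. x j)"
      using insert.hyps by (intro sum.cong) auto
    then show ?thesis using insert.hyps by simp
  qed
  have "(\<integral>\<^sup>+x. ennreal (\<bar>z + (\<Sum>j\<in>insert i I. x j)\<bar> powr p) \<partial>PiM (insert i I) \<nu>)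
     = (\<integral>\<^sup>+y. \<integral>\<^sup>+x. ennreal (\<bar>(z + y) + (\<Sum>j\<in>I. x j)\<bar> powr p) \<partial>PiM I \<nu> \<partial>\<nu> i)"
    by (subst N.product_nn_integral_insert_rev[OF insert.hyps meas[OF sets(2)]])
       (simp only: upd add.assoc)
  also have "\<dots> \<le> (\<integral>\<^sup>+y. \<integral>\<^sup>+x. ennreal (\<bar>(z + y) + (\<Sum>j\<in>I. x j)\<bar> powr p) \<partial>PiM I \<mu> \<partial>\<nu> i)"
    by (intro nn_integral_mono insert.IH insert.prems) auto
  also have "\<dots> = (\<integral>\<^sup>+x. \<integral>\<^sup>+y. ennreal (\<bar>(z + (\<Sum>j\<in>I. x j)) + y\<bar> powr p) \<partial>\<nu> i \<partial>PiM I \<mu>)"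
  proof -
    interpret F: finite_product_sigma_finite \<mu> I
      by standard (use insert.hyps in auto)
    interpret P: pair_sigma_finite "PiM I \<mu>" "\<nu> i"
      by standard
    have "(\<lambda>(x, y). \<bar>(z + y) + (\<Sum>j\<in>I. x j)\<bar> powr p) \<in> borel_measurable (PiM I \<mu> \<Otimes>\<^sub>M \<nu> i)"
    proof -
      have "(\<lambda>x. x j) \<in> borel_measurable (PiM I \<mu>)" if j: "j \<in> I" for j
        using measurable_component_singleton[OF j, of \<mu>] sets by (simp cong: measurable_cong_sets)
      then have [measurable]: "(\<lambda>x. \<Sum>j\<in>I. x j) \<in> borel_measurable (PiM I \<mu>)"
        by (intro borel_measurable_sum)
      have [measurable]: "(\<lambda>x. x) \<in> borel_measurable (\<nu> i)" by (rule measurable_ident_sets) (rule sets)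
      show ?thesis by measurable
    qed
    then have "(\<lambda>(x, y). ennreal (\<bar>(z + y) + (\<Sum>j\<in>I. x j)\<bar> powr p)) \<in> borel_measurable (PiM I \<mu> \<Otimes>\<^sub>M \<nu> i)"
      by (simp add: case_prod_beta')
    from P.Fubini'[OF this] show ?thesis by (simp add: ac_simps)
  qed
  also have "\<dots> \<le> (\<integral>\<^sup>+x. \<integral>\<^sup>+y. ennreal (\<bar>(z + (\<Sum>j\<in>I. x j)) + y\<bar> powr p) \<partial>\<mu> i \<partial>PiM I \<mu>)"
    by (intro nn_integral_mono insert.prems) auto
  also have "\<dots> = (\<integral>\<^sup>+x. ennreal (\<bar>z + (\<Sum>j\<in>insert i I. x j)\<bar> powr p) \<partial>PiM (insert i I) \<mu>)"
    by (subst M.product_nn_integral_insert[OF insert.hyps meas[OF sets(1)]])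
       (simp only: upd ac_simps)
  finally show ?case .
qed

subsection \<open>Symmetric laws and their tails\<close>

lemma symmetric_law_measure_uminus:
  assumes "symmetric_law \<mu>" and [measurable]: "A \<in> sets borel"
  shows "measure \<mu> {x. - x \<in> A} = measure \<mu> A"
proof -
  interpret real_distribution \<mu> using assms(1) by (simp add: symmetric_law_def)
  have "measure \<mu> A = measure (distr \<mu> borel uminus) A"
    using assms(1) by (simp add: symmetric_law_def)
  also have "\<dots> = measure \<mu> {x. - x \<in> A}"
    by (subst measure_distr) (auto simp: vimage_def)
  finally show ?thesis by simp
qed

lemma symmetric_law_measure_greaterThan:
  assumes "symmetric_law \<mu>" "t \<ge> 0"
  shows "measure \<mu> {t<..} = tail \<mu> t / 2"
proof -
  interpret real_distribution \<mu> using assms(1) by (simp add: symmetric_law_def)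
  have "{x. - x \<in> {t<..}} = {..<- t}" by auto
  then have "measure \<mu> {..<- t} = measure \<mu> {t<..}"
    using symmetric_law_measure_uminus[OF assms(1), of "{t<..}"] by simp
  moreover have "{x. \<bar>x\<bar> > t} = {t<..} \<union> {..<- t}" by auto
  moreover have "measure \<mu> ({t<..} \<union> {..<- t}) = measure \<mu> {t<..} + measure \<mu> {..<- t}"
    using assms(2) by (intro finite_measure_Union) auto
  ultimately show ?thesis by (simp add: tail_def)
qed

lemma symmetric_law_eqI:
  assumes \<mu>: "symmetric_law \<mu>" and \<nu>: "symmetric_law \<nu>"
    and eq: "\<And>t. t \<ge> 0 \<Longrightarrow> tail \<mu> t = tail \<nu> t"
  shows "\<mu> = \<nu>"
proof -
  interpret M: real_distribution \<mu> using \<mu> by (simp add: symmetric_law_def)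
  interpret N: real_distribution \<nu> using \<nu> by (simp add: symmetric_law_def)
  have pos: "measure \<mu> {t<..} = measure \<nu> {t<..}" if "t \<ge> 0" for t
    using symmetric_law_measure_greaterThan[OF \<mu> that] symmetric_law_measure_greaterThan[OF \<nu> that] eq[OF that] by simp
  have cdf: "cdf \<mu> t = cdf \<nu> t" if "t \<ge> 0" for t
  proof -
    have "{..t} = UNIV - {t<..}" by auto
    then show ?thesis
      using pos[OF that] M.prob_compl[of "{t<..}"] N.prob_compl[of "{t<..}"] by (simp add: cdf_def)
  qed
  \<comment> \<open>For \<open>x < 0\<close>, reflection takes \<open>{x<..}\<close> to the open
    half-line \<open>{..<- x}\<close>, whose mass is a left limit of the distribution function
    rather than a value of it.\<close>
  have less: "measure \<mu> {..<s} = measure \<nu> {..<s}" if "s > 0" for s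
  proof (rule tendsto_unique)
    show "(cdf \<nu> \<longlongrightarrow> measure \<mu> {..<s}) (at_left s)"
    proof (rule Lim_transform_eventually[OF M.cdf_at_left])
      show "\<forall>\<^sub>F x in at_left s. cdf \<mu> x = cdf \<nu> x"
        using eventually_at_left_real[OF that] by eventually_elim (auto intro!: cdf)
    qed
    show "(cdf \<nu> \<longlongrightarrow> measure \<nu> {..<s}) (at_left s)" by (rule N.cdf_at_left)
  qed simp
  have "measure \<mu> {x<..} = measure \<nu> {x<..}" for x
  proof (cases "x \<ge> 0")
    case False
    have *: "{y. - y \<in> {..<- x}} = {x<..}" by auto
    show ?thesis
      using symmetric_law_measure_uminus[OF \<mu>, of "{..<- x}"] symmetric_law_measure_uminus[OF \<nu>, of "{..<- x}"]
        less[of "- x"] False unfolding * by simp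
  qed (rule pos)
  then show ?thesis
    by (intro measure_eqI_lessThan) (auto simp: M.emeasure_eq_measure N.emeasure_eq_measure)
qed

lemma tail_right_continuous:
  assumes "real_distribution \<mu>"
  shows "(tail \<mu> \<longlongrightarrow> tail \<mu> t) (at_right t)"
proof -
  interpret real_distribution \<mu> by fact
  interpret D: real_distribution "distr \<mu> borel abs" by (rule real_distribution_distr) simp
  have "tail \<mu> t = 1 - cdf (distr \<mu> borel abs) t" for t
  proof -
    have "cdf (distr \<mu> borel abs) t = measure \<mu> {x. \<bar>x\<bar> \<le> t}"
      unfolding cdf_def by (subst measure_distr) (auto simp: vimage_def)
    moreover have "UNIV - {x. \<bar>x\<bar> > t} = {x. \<bar>x\<bar> \<le> t}" by auto
    ultimately show ?thesis using prob_compl[of "{x. \<bar>x\<bar> > t}"] by (simp add: tail_def)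
  qed
  then have eq: "tail \<mu> = (\<lambda>t. 1 - cdf (distr \<mu> borel abs) t)" by (auto simp: fun_eq_iff)
  show ?thesis unfolding eq
    using D.cdf_is_right_cont[of t] by (intro tendsto_diff tendsto_const) (simp add: continuous_within)
qed

lemma AE_lborel_interval_nonempty:
  assumes ae: "AE u in lborel. u \<notin> {a<..<b::real}"
  shows "b \<le> a"
proof (rule ccontr)
  assume "\<not> b \<le> a"
  moreover have "{a<..<b} \<in> null_sets lborel" using ae by (simp add: AE_iff_null_sets)
  ultimately show False by (auto simp: null_sets_def)
qed

text \<open>By right continuity a strict inequality at \<open>t\<close> would persist on an interval
  to the right of \<open>t\<close>, which is not a null set.\<close>

lemma tail_le_of_AE_eq:
  assumes "real_distribution \<mu>" "real_distribution \<nu>" "t \<ge> 0"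
    and ae: "AE u in lborel. 0 < u \<longrightarrow> tail \<mu> u = tail \<nu> u"
  shows "tail \<mu> t \<le> tail \<nu> t"
proof (rule ccontr)
  assume "\<not> ?thesis"
  moreover have "((\<lambda>u. tail \<mu> u - tail \<nu> u) \<longlongrightarrow> tail \<mu> t - tail \<nu> t) (at_right t)"
    using assms by (intro tendsto_diff tail_right_continuous)
  ultimately have "\<forall>\<^sub>F u in at_right t. 0 < tail \<mu> u - tail \<nu> u"
    by (intro order_tendstoD) auto
  then obtain b where b: "b > t" "\<And>u. t < u \<Longrightarrow> u < b \<Longrightarrow> tail \<mu> u \<noteq> tail \<nu> u"
    by (force simp: eventually_at_right_field)
  have "AE u in lborel. u \<notin> {t<..<b}"
    using ae by eventually_elim (use b(2) assms(3) in force)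
  then show False using AE_lborel_interval_nonempty b(1) by fastforce
qed

lemma symmetric_law_eq_of_crosses_up:
  assumes \<mu>: "symmetric_law \<mu>" and \<nu>: "symmetric_law \<nu>" and p: "p > 2"
    and 2: "has_tail_moment 2 (tail \<mu>) m" "has_tail_moment 2 (tail \<nu>) m"
    and P: "has_tail_moment p (tail \<mu>) m'" "has_tail_moment p (tail \<nu>) m'"
    and cr: "crosses_up (tail \<mu>) (tail \<nu>)"
  shows "\<mu> = \<nu>"
proof (rule symmetric_law_eqI[OF \<mu> \<nu>])
  have rd: "real_distribution \<mu>" "real_distribution \<nu>" using \<mu> \<nu> by (auto simp: symmetric_law_def)
  have ae: "AE u in lborel. 0 < u \<longrightarrow> tail \<mu> u = tail \<nu> u"
    by (rule tail_moment_mono_of_crosses_up(2)[OF p 2 P cr refl])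
  then have ae': "AE u in lborel. 0 < u \<longrightarrow> tail \<nu> u = tail \<mu> u" by eventually_elim auto
  show "tail \<mu> t = tail \<nu> t" if "t \<ge> 0" for t
    using tail_le_of_AE_eq[OF rd that ae] tail_le_of_AE_eq[OF rd(2,1) that ae'] by simp
qed

text \<open>The law is that of \<open>sgn x * max 0 (g |x|)\<close> for \<open>x\<close> uniform on the interval from \<open>-1\<close> to \<open>1\<close>.\<close>

lemma symmetric_law_with_tail:
  fixes g T :: "real \<Rightarrow> real"
  assumes [measurable]: "g \<in> borel_measurable borel"
    and T: "\<And>t. t \<ge> 0 \<Longrightarrow> 0 \<le> T t \<and> T t \<le> 1"
    and g: "\<And>t r. t \<ge> 0 \<Longrightarrow> 0 < r \<Longrightarrow> r < 1 \<Longrightarrow> t < g r \<longleftrightarrow> r < T t"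
  shows "\<exists>\<mu>. symmetric_law \<mu> \<and> (\<forall>t\<ge>0. tail \<mu> t = T t)"
proof -
  define U where "U = uniform_measure lborel {-1<..<1::real}"
  interpret U: prob_space U
    unfolding U_def by (intro prob_space_uniform_measure) auto
  define X where "X = (\<lambda>x. sgn x * max 0 (g \<bar>x\<bar>))"
  have [measurable]: "X \<in> borel_measurable borel" unfolding X_def by measurable
  have sU[measurable_cong, simp]: "sets U = sets borel" "space U = UNIV" by (auto simp: U_def)
  have U_sym: "distr U borel uminus = U"
  proof (rule measure_eqI)
    fix A assume "A \<in> sets (distr U borel uminus)"
    then have [measurable]: "A \<in> sets borel" by simp
    have "emeasure (distr U borel uminus) A = emeasure U {x. - x \<in> A}"
      by (subst emeasure_distr) (auto simp: vimage_def)
    also have "\<dots> = emeasure lborel ({-1<..<1} \<inter> {x. - x \<in> A}) / 2"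
      by (simp add: U_def emeasure_uniform_measure)
    also have "emeasure lborel ({-1<..<1} \<inter> {x. - x \<in> A}) = emeasure (distr lborel borel uminus) ({-1<..<1} \<inter> A)"
      by (subst emeasure_distr) (auto simp: vimage_def intro!: arg_cong[where f = "emeasure lborel"])
    also have "\<dots> = emeasure lborel ({-1<..<1} \<inter> A)" by (simp add: lborel_distr_uminus)
    also have "\<dots> / 2 = emeasure U A" by (simp add: U_def emeasure_uniform_measure)
    finally show "emeasure (distr U borel uminus) A = emeasure U A" .
  qed simp
  define \<mu> where "\<mu> = distr U borel X"
  have rd: "real_distribution \<mu>"
    unfolding \<mu>_def by (rule U.real_distribution_distr) simp
  have "distr \<mu> borel uminus = distr U borel (\<lambda>x. X (- x))"
    unfolding \<mu>_def by (subst distr_distr) (auto simp: comp_def X_def sgn_minus)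
  also have "\<dots> = distr (distr U borel uminus) borel X"
    by (subst distr_distr) (auto simp: comp_def)
  finally have sym: "symmetric_law \<mu>"
    using rd by (simp add: symmetric_law_def U_sym \<mu>_def)
  have "tail \<mu> t = T t" if t: "t \<ge> 0" for t
  proof -
    have "tail \<mu> t = measure U {x. \<bar>X x\<bar> > t}"
      unfolding tail_def \<mu>_def by (subst measure_distr) (auto simp: vimage_def)
    also have "\<dots> = measure lborel ({-1<..<1} \<inter> {x. \<bar>X x\<bar> > t}) / 2"
    proof -
      have "{x. \<bar>X x\<bar> > t} \<in> sets borel" by measurable
      then show ?thesis by (simp add: U_def measure_uniform_measure)
    qed
    \<comment> \<open>\<open>g\<close> is a generalised inverse of \<open>T\<close>, so
      \<open>\<bar>X x\<bar> > t\<close> means \<open>\<bar>x\<bar> < T t\<close>; the origin drops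
      out because \<open>sgn 0 = 0\<close>.\<close>
    also have "{-1<..<1} \<inter> {x. \<bar>X x\<bar> > t} = {- T t<..<T t} - {0}"
    proof -
      have "-1 < x \<and> x < 1 \<and> \<bar>X x\<bar> > t \<longleftrightarrow> - T t < x \<and> x < T t \<and> x \<noteq> 0" for x
      proof (cases "x = 0 \<or> \<bar>x\<bar> \<ge> 1")
        case True
        then show ?thesis using T[OF t] t by (auto simp: X_def)
      next
        case False
        then have "\<bar>X x\<bar> > t \<longleftrightarrow> t < g \<bar>x\<bar>" using t by (auto simp: X_def abs_mult max_def)
        also have "\<dots> \<longleftrightarrow> \<bar>x\<bar> < T t" using g[OF t, of "\<bar>x\<bar>"] False by auto
        finally show ?thesis using False by auto
      qed
      then show ?thesis
        by (intro set_eqI) (simp only: Int_iff greaterThanLessThan_iff mem_Collect_eq Diff_iff singleton_iff, blast)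
    qed
    also have "measure lborel ({- T t<..<T t} - {0}) = measure lborel {- T t<..<T t}"
      by (intro measure_Diff_null_set) auto
    also have "\<dots> / 2 = T t" using T[OF t] by simp
    finally show ?thesis .
  qed
  with sym show ?thesis by blast
qed

subsection \<open>Existence of matching members\<close>

lemma has_tail_moment_scale:
  assumes "has_tail_moment q T m" "\<kappa> > 0"
  shows "has_tail_moment q (\<lambda>u. T (u / \<kappa>)) (\<kappa> powr q * m)"
proof -
  have "has_bochner_integral lborel (\<lambda>u. \<kappa> powr (q - 1) * (indicator {0<..} u * (u powr (q - 1) * T u))) (\<kappa> powr (q - 1) * m)"
    using assms(1) unfolding has_tail_moment_def by (intro has_bochner_integral_mult_right)
  also have "(\<lambda>u. \<kappa> powr (q - 1) * (indicator {0<..} u * (u powr (q - 1) * T u)))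
     = (\<lambda>u. indicator {0<..} (0 + \<kappa> * u) * ((0 + \<kappa> * u) powr (q - 1) * T ((0 + \<kappa> * u) / \<kappa>)))"
    using assms(2) by (auto simp: indicator_def powr_mult fun_eq_iff zero_less_mult_iff)
  finally show ?thesis
    unfolding has_tail_moment_def
    using assms(2) by (subst lborel_has_bochner_integral_real_affine_iff[of \<kappa> _ _ 0])
      (auto simp: powr_diff divide_inverse ac_simps)
qed

text \<open>A multiple of the Gamma integrand. The factor \<open>exp (1 - u)\<close> bounds both
  interpolating families below, so this function dominates their moment integrands.\<close>

lemma integrable_powr_exp_minus:
  fixes q :: real
  assumes "q > 0"
  shows "integrable lborel (\<lambda>u. indicator {0<..} u * (u powr (q - 1) * exp (1 - u)))"
proof -
  have "(\<integral>\<^sup>+u. ennreal (indicator {0..} u * u powr (q - 1) / exp u) \<partial>lborel) = ennreal (Gamma q)"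
    using Gamma_conv_nn_integral_real[OF assms] by simp
  then have "integrable lborel (\<lambda>u. indicator {0..} u * u powr (q - 1) / exp u)"
    by (intro integrableI_nonneg) auto
  then have "integrable lborel (\<lambda>u. exp 1 * (indicator {0..} u * u powr (q - 1) / exp u))"
    by (rule integrable_mult_right)
  also have "(\<lambda>u. exp 1 * (indicator {0..} u * u powr (q - 1) / exp u))
      = (\<lambda>u. indicator {0<..} u * (u powr (q - 1) * exp (1 - u)))"
    by (auto simp: indicator_def exp_diff fun_eq_iff)
  finally show ?thesis .
qed

text \<open>
  By scaling, only the ratio of the \<open>p\<close>-th moment to a power of the second one has to be matched;
  the crossing hypotheses place the target between the ratios at the end points \<open>0\<close> and \<open>1\<close>.
\<close>

lemma interpolating_tail_matching_moments:
  fixes T :: "real \<Rightarrow> real \<Rightarrow> real" and p :: real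
  assumes p: "p > 2"
    and meas: "\<And>l. l \<in> {0..1} \<Longrightarrow> T l \<in> borel_measurable borel"
    and lower: "\<And>l u. l \<in> {0..1} \<Longrightarrow> 0 < u \<Longrightarrow> u < 1 \<Longrightarrow> 0 < T l u"
    and bounds: "\<And>l u. l \<in> {0..1} \<Longrightarrow> 0 < u \<Longrightarrow> 0 \<le> T l u \<and> T l u \<le> exp (1 - u)"
    and cont: "\<And>l. l \<in> {0..1} \<Longrightarrow> \<exists>c. \<forall>u>0. u \<noteq> c \<longrightarrow> ((\<lambda>k. T k u) \<longlongrightarrow> T l u) (at l within {0..1})"
    and S: "has_tail_moment 2 S A" "has_tail_moment p S B" "A > 0"
    and cr0: "\<And>\<kappa>. \<kappa> > 0 \<Longrightarrow> crosses_up S (\<lambda>u. T 0 (u / \<kappa>))"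
    and cr1: "\<And>\<kappa>. \<kappa> > 0 \<Longrightarrow> crosses_up (\<lambda>u. T 1 (u / \<kappa>)) S"
  shows "\<exists>l\<in>{0..1}. \<exists>\<kappa>>0. has_tail_moment 2 (\<lambda>u. T l (u / \<kappa>)) A \<and> has_tail_moment p (\<lambda>u. T l (u / \<kappa>)) B"
proof -
  define f where "f = (\<lambda>q l u. indicator {0<..} u * (u powr (q - 1) * T l u))"
  define M where "M = (\<lambda>q l. integral\<^sup>L lborel (f q l))"
  define b where "b = (\<lambda>q u. indicator {0<..} u * (u powr (q - 1) * exp (1 - u)) :: real)"
  have meas_f[measurable]: "f q l \<in> borel_measurable borel" if "l \<in> {0..1}" for q l
    using meas[OF that] unfolding f_def by measurable
  have b: "integrable lborel (b q)" if "q > 0" for q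
    unfolding b_def by (rule integrable_powr_exp_minus[OF that])
  have fb: "norm (f q l u) \<le> b q u" if "l \<in> {0..1}" for q l u
    using bounds[OF that, of u] by (auto simp: f_def b_def indicator_def intro!: mult_left_mono)
  have f0: "0 \<le> f q l u" if "l \<in> {0..1}" for q l u
    using bounds[OF that, of u] by (auto simp: f_def indicator_def)
  have int: "integrable lborel (f q l)" if "q > 0" "l \<in> {0..1}" for q l
    by (rule Bochner_Integration.integrable_bound[OF b[OF that(1)]])
       (use fb[OF that(2), of q] meas_f[OF that(2)] in \<open>auto intro: order_trans[OF _ abs_ge_self]\<close>)
  have mom: "has_tail_moment q (T l) (M q l)" if "q > 0" "l \<in> {0..1}" for q l
    using int[OF that] unfolding has_tail_moment_def M_def f_def
    by (rule has_bochner_integral_integrable)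
  have Mpos: "M q l > 0" if q: "q > 0" and l: "l \<in> {0..1}" for q l
  proof -
    have "M q l \<ge> 0" unfolding M_def using f0[OF l] by simp
    moreover have "M q l \<noteq> 0"
    proof
      assume "M q l = 0"
      then have "AE u in lborel. f q l u = 0"
        using integral_nonneg_eq_0_iff_AE[OF int[OF q l]] f0[OF l] by (simp add: M_def)
      then have "AE u in lborel. u \<notin> {0<..<1::real}"
        by eventually_elim (use lower[OF l] in \<open>force simp: f_def\<close>)
      then show False using AE_lborel_interval_nonempty[of 0 1] by simp
    qed
    ultimately show ?thesis by simp
  qed
  have Mcont: "continuous_on {0..1} (M q)" if q: "q > 0" for q
    unfolding continuous_on_sequentially
  proof (intro allI ballI impI, elim conjE)
    fix x :: "nat \<Rightarrow> real" and l assume l: "l \<in> {0..1}" and x: "\<forall>n. x n \<in> {0..1}" "x \<longlonglongrightarrow> l"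
    obtain c where c: "\<And>u. u > 0 \<Longrightarrow> u \<noteq> c \<Longrightarrow> ((\<lambda>k. T k u) \<longlongrightarrow> T l u) (at l within {0..1})"
      using cont[OF l] by blast
    have "(\<lambda>n. integral\<^sup>L lborel (f q (x n))) \<longlonglongrightarrow> integral\<^sup>L lborel (f q l)"
    proof (rule integral_dominated_convergence[OF _ _ b[OF q]])
      show "AE u in lborel. (\<lambda>n. f q (x n) u) \<longlonglongrightarrow> f q l u"
        using AE_lborel_singleton[of c]
      proof eventually_elim
        case (elim u)
        show ?case
        proof (cases "u > 0")
          case True
          have "((\<lambda>k. T k u) \<longlongrightarrow> T l u) (at l within {0..1})" by (rule c) (use True elim in auto)
          then have "continuous (at l within {0..1}) (\<lambda>k. T k u)" by (simp only: continuous_within)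
          then have "(\<lambda>n. T (x n) u) \<longlonglongrightarrow> T l u"
            using x unfolding continuous_within_sequentially comp_def by blast
          then show ?thesis unfolding f_def by (intro tendsto_mult tendsto_const)
        qed (simp add: f_def)
      qed
    qed (use meas_f l x fb in auto)
    then show "(M q \<circ> x) \<longlonglongrightarrow> M q l" by (simp add: M_def comp_def)
  qed
  \<comment> \<open>\<open>F\<close> is invariant under dilation. Dilating by
    \<open>\<kappa> l\<close> makes the second tail moment equal to \<open>A\<close>, and the
    \<open>p\<close>-th one becomes \<open>A powr (p / 2) * F l\<close>.\<close>
  define F where "F = (\<lambda>l. M p l / M 2 l powr (p / 2))"
  define \<kappa> where "\<kappa> = (\<lambda>l. sqrt (A / M 2 l))"
  have \<kappa>pos: "\<kappa> l > 0" if "l \<in> {0..1}" for l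
    using Mpos[OF _ that, of 2] S(3) by (simp add: \<kappa>_def)
  have \<kappa>2: "has_tail_moment 2 (\<lambda>u. T l (u / \<kappa> l)) A" if l: "l \<in> {0..1}" for l
  proof -
    have "\<kappa> l powr 2 * M 2 l = A"
      using \<kappa>pos[OF l] Mpos[OF _ l, of 2] S(3) by (simp add: \<kappa>_def)
    then show ?thesis using has_tail_moment_scale[OF mom[OF _ l, of 2] \<kappa>pos[OF l]] by simp
  qed
  have \<kappa>p: "has_tail_moment p (\<lambda>u. T l (u / \<kappa> l)) (A powr (p / 2) * F l)" if l: "l \<in> {0..1}" for l
  proof -
    have "\<kappa> l powr p = A powr (p / 2) / M 2 l powr (p / 2)"
      using Mpos[OF _ l, of 2] S(3) by (simp add: \<kappa>_def powr_half_sqrt[symmetric] powr_powr powr_divide)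
    then show ?thesis using has_tail_moment_scale[OF mom[OF _ l, of p] \<kappa>pos[OF l]] p by (simp add: F_def)
  qed
  have A0: "A powr (p / 2) > 0" using S(3) by simp
  \<comment> \<open>The crossings at the end points give
    \<open>F 0 \<le> B / A powr (p / 2) \<le> F 1\<close>, so the intermediate value theorem
    supplies the parameter.\<close>
  have "A powr (p / 2) * F 0 \<le> B"
    by (rule tail_moment_mono_of_crosses_up(1)[OF p S(1) \<kappa>2 S(2) \<kappa>p cr0]) (auto intro: \<kappa>pos)
  then have lo: "F 0 \<le> B / A powr (p / 2)" using A0 by (simp add: field_simps)
  have "B \<le> A powr (p / 2) * F 1"
    by (rule tail_moment_mono_of_crosses_up(1)[OF p \<kappa>2 S(1) \<kappa>p S(2) cr1]) (auto intro: \<kappa>pos)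
  then have hi: "B / A powr (p / 2) \<le> F 1" using A0 by (simp add: field_simps)
  have "continuous_on {0..1} F"
    unfolding F_def
  proof (intro continuous_on_divide continuous_on_powr Mcont continuous_on_const ballI)
    fix l :: real assume "l \<in> {0..1}"
    from Mpos[OF _ this, of 2] show "M 2 l \<noteq> 0" "M 2 l powr (p / 2) \<noteq> 0" by auto
  qed (use p in auto)
  from IVT'[OF lo hi _ this] obtain l where l: "0 \<le> l" "l \<le> 1" "F l = B / A powr (p / 2)" by auto
  have "has_tail_moment p (\<lambda>u. T l (u / \<kappa> l)) B"
    using \<kappa>p[of l] l A0 by simp
  moreover have "has_tail_moment 2 (\<lambda>u. T l (u / \<kappa> l)) A" "\<kappa> l > 0" using \<kappa>2 \<kappa>pos l by auto
  ultimately show ?thesis using l by (intro bexI[of _ l] exI[of _ "\<kappa> l"]) auto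
qed

text \<open>Since \<open>S 0 = 1\<close>, the logarithm of \<open>S\<close> starts on the line
  through the origin with slope \<open>- a\<close>. If it were on or above that line at
  \<open>v\<close>, concavity between 0 and \<open>v\<close> would keep it on or above at
  \<open>u\<close>.\<close>

lemma log_concave_tail_below_exp:
  assumes lc: "log_concave_on_nonneg S" and S: "S 0 = 1" "S v \<ge> 0"
    and uv: "0 < u" "u < v" and less: "S u < exp (- a * u)"
  shows "S v < exp (- a * v)"
proof (rule ccontr)
  assume *: "\<not> ?thesis"
  define l where "l = u / v"
  have l: "0 < l" "l < 1" "l * v = u" using uv by (auto simp: l_def)
  have "S u \<ge> S 0 powr (1 - l) * S v powr l"
    using lc l uv unfolding log_concave_on_nonneg_def
    by (metis (no_types, opaque_lifting) add.left_neutral less_eq_real_def less_trans mult_zero_right)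
  moreover have "S v powr l \<ge> exp (- a * v) powr l" using * l by (intro powr_mono2) auto
  moreover have "exp (- a * v) powr l = exp (- a * u)"
    using l by (simp add: powr_def mult.assoc[symmetric] mult.commute[of l])
  ultimately show False using less S by simp
qed

lemma G_minus_matching_moments:
  fixes p :: real
  assumes p: "p > 2" and \<mu>: "\<mu> \<in> log_concave_tail_laws"
    and S: "has_tail_moment 2 (tail \<mu>) A" "has_tail_moment p (tail \<mu>) B" "A > 0"
  shows "\<exists>\<nu>\<in>G_minus. has_tail_moment 2 (tail \<nu>) A \<and> has_tail_moment p (tail \<nu>) B"
proof -
  have sym: "symmetric_law \<mu>" and S0: "tail \<mu> 0 = 1" and lc: "log_concave_on_nonneg (tail \<mu>)"
    using \<mu> by (auto simp: log_concave_tail_laws_def)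
  have rd: "real_distribution \<mu>" using sym by (simp add: symmetric_law_def)
  note tb = tail_bounds[OF rd]
  \<comment> \<open>Up to scale, this is the class as a one-parameter family: rate
    \<open>1 / l\<close> beyond the point \<open>1 - l\<close>, running from the random sign at
    \<open>l = 0\<close> to the two-sided exponential at \<open>l = 1\<close>.\<close>
  define T where "T = (\<lambda>l u. if l = 0 then indicator {..<1} u else exp (- (max (u - (1 - l)) 0 / l)) :: real)"
  have "\<exists>l\<in>{0..1}. \<exists>\<kappa>>0. has_tail_moment 2 (\<lambda>u. T l (u / \<kappa>)) A \<and> has_tail_moment p (\<lambda>u. T l (u / \<kappa>)) B"
  proof (rule interpolating_tail_matching_moments[OF p _ _ _ _ S])
    show "T l \<in> borel_measurable borel" for l unfolding T_def by measurable
    show "0 < T l u" if "l \<in> {0..1}" "0 < u" "u < 1" for l u using that by (auto simp: T_def)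
    show "0 \<le> T l u \<and> T l u \<le> exp (1 - u)" if l: "l \<in> {0..1}" and u: "0 < u" for l u
    proof (cases "l = 0")
      case False
      have "u - 1 \<le> max (u - (1 - l)) 0 / l"
      proof (cases "u \<le> 1")
        case True
        then have "u - 1 \<le> 0" by simp
        also have "0 \<le> max (u - (1 - l)) 0 / l" using l by simp
        finally show ?thesis .
      next
        case False
        have "(u - 1) * l \<le> u - 1" using False l by (simp add: mult_left_le)
        then show ?thesis using False l \<open>l \<noteq> 0\<close> by (simp add: field_simps)
      qed
      then show ?thesis using False by (simp add: T_def)
    qed (auto simp: T_def indicator_def)
    show "\<exists>c. \<forall>u>0. u \<noteq> c \<longrightarrow> ((\<lambda>k. T k u) \<longlongrightarrow> T l u) (at l within {0..1})" if l: "l \<in> {0..1}" for l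
    proof (cases "l = 0")
      case False
      have "((\<lambda>k. T k u) \<longlongrightarrow> T l u) (at l within {0..1})" for u
      proof (rule Lim_transform_eventually)
        show "((\<lambda>k. exp (- (max (u - (1 - k)) 0 / k))) \<longlongrightarrow> T l u) (at l within {0..1})"
          using False by (auto simp: T_def intro!: tendsto_intros)
        have "\<forall>\<^sub>F k in at l within {0..1}. k \<noteq> 0"
          using False tendsto_ident_at[of l "{0..1}"] by (rule tendsto_imp_eventually_ne[rotated])
        then show "\<forall>\<^sub>F k in at l within {0..1}. exp (- (max (u - (1 - k)) 0 / k)) = T k u"
          by eventually_elim (simp add: T_def)
      qed
      then show ?thesis by blast
    next
      case l0: True
      have k0: "\<forall>\<^sub>F k in at 0 within {0..1}. 0 < k \<and> k \<le> (1::real)"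
        by (auto simp: eventually_at_filter)
      \<comment> \<open>The exceptional point is 1: \<open>T k 1 = exp (- 1)\<close> for every
        positive \<open>k\<close>, whereas \<open>T 0 1 = 0\<close>.\<close>
      have "((\<lambda>k. T k u) \<longlongrightarrow> T 0 u) (at 0 within {0..1})" if u: "u > 0" "u \<noteq> 1" for u
      proof (cases "u < 1")
        case True
        have "\<forall>\<^sub>F k in at 0 within {0..1}. k < 1 - u"
          using order_tendstoD(2)[OF tendsto_ident_at[of 0 "{0..1}"], of "1 - u"] True by simp
        with k0 have "\<forall>\<^sub>F k in at 0 within {0..1}. T 0 u = T k u"
          by eventually_elim (use True in \<open>auto simp: T_def\<close>)
        then show ?thesis by (rule Lim_transform_eventually[OF tendsto_const])
      next
        case False
        \<comment> \<open>Here \<open>T k u = exp (- x)\<close> with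
          \<open>x \<ge> (u - 1) / k\<close>, and \<open>exp (- x) \<le> 1 / x\<close> gives a bound
          that vanishes with \<open>k\<close>.\<close>
        have "\<forall>\<^sub>F k in at 0 within {0..1}. norm (T k u) \<le> k / (u - 1)"
          using k0
        proof eventually_elim
          case (elim k)
          define x where "x = (u - (1 - k)) / k"
          have x: "x > 0" using elim False u by (auto simp: x_def)
          have "T k u = 1 / exp x" using elim False u by (simp add: T_def x_def exp_minus field_simps)
          also have "\<dots> \<le> 1 / x"
          proof -
            have "x \<le> exp x" using exp_ge_add_one_self[of x] by linarith
            then show ?thesis using x by (intro divide_left_mono) auto
          qed
          also have "\<dots> \<le> k / (u - 1)" using elim False u by (auto simp: x_def intro!: divide_left_mono)
          finally show ?case using \<open>T k u = 1 / exp x\<close> by simp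
        qed
        moreover have "((\<lambda>k. k / (u - 1)) \<longlongrightarrow> 0) (at 0 within {0..1})"
          using u by (auto intro!: tendsto_eq_intros)
        ultimately have "((\<lambda>k. T k u) \<longlongrightarrow> 0) (at 0 within {0..1})" by (rule Lim_null_comparison)
        then show ?thesis using False by (simp add: T_def)
      qed
      then show ?thesis unfolding l0 by blast
    qed
    show "crosses_up (tail \<mu>) (\<lambda>u. T 0 (u / \<kappa>))" if "\<kappa> > 0" for \<kappa>
      unfolding crosses_up_def
    proof (intro allI impI)
      fix u v assume *: "0 < u \<and> u < v \<and> T 0 (u / \<kappa>) < tail \<mu> u"
      \<comment> \<open>Before \<open>\<kappa>\<close> the step tail equals 1 and cannot be
        exceeded; from \<open>\<kappa>\<close> on it is 0.\<close>
      have "\<kappa> \<le> u"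
      proof (rule ccontr)
        assume "\<not> \<kappa> \<le> u"
        then have "T 0 (u / \<kappa>) = 1" using that by (simp add: T_def)
        then show False using * tb(2)[of u] by simp
      qed
      then show "T 0 (v / \<kappa>) \<le> tail \<mu> v" using * that tb(1) by (auto simp: T_def indicator_def)
    qed
    show "crosses_up (\<lambda>u. T 1 (u / \<kappa>)) (tail \<mu>)" if \<kappa>: "\<kappa> > 0" for \<kappa>
      unfolding crosses_up_def
    proof (intro allI impI)
      fix u v assume *: "0 < u \<and> u < v \<and> tail \<mu> u < T 1 (u / \<kappa>)"
      have T1: "T 1 (x / \<kappa>) = exp (- (1 / \<kappa>) * x)" if "x > 0" for x
      proof -
        have "x / \<kappa> > 0" using that \<kappa> by simp
        then show ?thesis by (simp add: T_def max_absorb1)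
      qed
      have "tail \<mu> v < exp (- (1 / \<kappa>) * v)"
        by (rule log_concave_tail_below_exp[OF lc S0 tb(1), where u = u]) (use * T1[of u] in auto)
      then show "tail \<mu> v \<le> T 1 (v / \<kappa>)" using * T1[of v] by simp
    qed
  qed
  then obtain l \<kappa> where l: "0 \<le> l" "l \<le> 1" and \<kappa>: "\<kappa> > 0"
    and m: "has_tail_moment 2 (\<lambda>u. T l (u / \<kappa>)) A" "has_tail_moment p (\<lambda>u. T l (u / \<kappa>)) B" by auto
  have "\<exists>\<nu>\<in>G_minus. \<forall>t\<ge>0. tail \<nu> t = T l (t / \<kappa>)"
  proof (cases "l = 0")
    case True
    have "\<exists>\<nu>. symmetric_law \<nu> \<and> (\<forall>t\<ge>0. tail \<nu> t = indicator {0..<\<kappa>} t)"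
      by (rule symmetric_law_with_tail[of "\<lambda>_. \<kappa>"]) (use \<kappa> in \<open>auto simp: indicator_def\<close>)
    then obtain \<nu> where \<nu>: "symmetric_law \<nu>" "\<forall>t\<ge>0. tail \<nu> t = indicator {0..<\<kappa>} t" by blast
    then have "\<nu> \<in> G_minus" using \<kappa> by (auto simp: G_minus_def intro!: exI[of _ \<kappa>])
    with \<nu>(2) show ?thesis using \<kappa> True by (intro bexI[of _ \<nu>]) (auto simp: T_def indicator_def)
  next
    case False
    \<comment> \<open>Read off from \<open>T l (t / \<kappa>)\<close>: the exponent is
      \<open>(t / \<kappa> - (1 - l)) / l = a * (t - b)\<close> beyond \<open>b\<close>.\<close>
    define a b where "a = 1 / (l * \<kappa>)" and "b = \<kappa> * (1 - l)"
    have ab: "a > 0" "b \<ge> 0" using \<kappa> l False by (auto simp: a_def b_def)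
    have "\<exists>\<nu>. symmetric_law \<nu> \<and> (\<forall>t\<ge>0. tail \<nu> t = exp (- a * max (t - b) 0))"
    proof (rule symmetric_law_with_tail[of "\<lambda>r. b - ln r / a"])
      fix t r :: real assume tr: "t \<ge> 0" "0 < r" "r < 1"
      have "r < exp (- a * max (t - b) 0) \<longleftrightarrow> ln r < - a * max (t - b) 0"
        using tr by (metis exp_less_cancel_iff exp_ln)
      also have "\<dots> \<longleftrightarrow> t < b - ln r / a"
      proof (cases "t \<le> b")
        case True
        moreover have "ln r < 0" using tr by simp
        moreover have "ln r / a < 0" using ab(1) \<open>ln r < 0\<close> by (rule divide_neg_pos[rotated])
        ultimately show ?thesis by simp
      next
        case False
        then show ?thesis using ab(1) by (simp add: max_absorb1 field_simps)
      qed
      finally show "t < b - ln r / a \<longleftrightarrow> r < exp (- a * max (t - b) 0)" by simp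
    qed (use ab in auto)
    then obtain \<nu> where \<nu>: "symmetric_law \<nu>" "\<forall>t\<ge>0. tail \<nu> t = exp (- a * max (t - b) 0)" by blast
    then have "\<nu> \<in> G_minus" using ab unfolding G_minus_def by (blast intro: less_imp_le)
    moreover have "a * max (t - b) 0 = max (t / \<kappa> - (1 - l)) 0 / l" for t
    proof -
      have "a * (t - b) = (t / \<kappa> - (1 - l)) / l" using False \<kappa> by (simp add: a_def b_def field_simps)
      moreover have "a * max (t - b) 0 = max (a * (t - b)) 0"
        using ab(1) by (simp add: max_mult_distrib_left)
      moreover have "max (t / \<kappa> - (1 - l)) 0 / l = max ((t / \<kappa> - (1 - l)) / l) 0"
        using l False by (simp add: max_divide_distrib_right)
      ultimately show ?thesis by simp
    qed
    ultimately show ?thesis using \<nu>(2) False by (intro bexI[of _ \<nu>]) (auto simp: T_def)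
  qed
  then obtain \<nu> where \<nu>: "\<nu> \<in> G_minus" "\<And>t. t \<ge> 0 \<Longrightarrow> tail \<nu> t = T l (t / \<kappa>)" by blast
  have eq: "(\<lambda>u. indicator {0<..} u * (u powr (q - 1) * T l (u / \<kappa>))) = (\<lambda>u. indicator {0<..} u * (u powr (q - 1) * tail \<nu> u))" for q
    using \<nu>(2) by (auto simp: indicator_def)
  show ?thesis using \<nu>(1) m unfolding has_tail_moment_def eq by blast
qed

text \<open>The same two end points as for \<open>G_minus\<close>, now joined by exponential tails
  of rate \<open>s\<close> with a cutoff that recedes to infinity as \<open>s\<close> tends to
  1.\<close>

lemma G_plus_matching_moments:
  fixes p :: real
  assumes p: "p > 2" and \<mu>: "\<mu> \<in> log_concave_tail_laws"
    and S: "has_tail_moment 2 (tail \<mu>) A" "has_tail_moment p (tail \<mu>) B" "A > 0"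
  shows "\<exists>\<nu>\<in>G_plus. has_tail_moment 2 (tail \<nu>) A \<and> has_tail_moment p (tail \<nu>) B"
proof -
  have sym: "symmetric_law \<mu>" and S0: "tail \<mu> 0 = 1" and lc: "log_concave_on_nonneg (tail \<mu>)"
    using \<mu> by (auto simp: log_concave_tail_laws_def)
  have rd: "real_distribution \<mu>" using sym by (simp add: symmetric_law_def)
  note tb = tail_bounds[OF rd]
  \<comment> \<open>the cutoff at \<open>1 / (1 - s)\<close>, stated so that \<open>s = 1\<close> gives the exponential tail without cutoff\<close>
  define T where "T = (\<lambda>s u. exp (- s * u) * (if (1 - s) * u < 1 then 1 else 0) :: real)"
  have "\<exists>s\<in>{0..1}. \<exists>\<kappa>>0. has_tail_moment 2 (\<lambda>u. T s (u / \<kappa>)) A \<and> has_tail_moment p (\<lambda>u. T s (u / \<kappa>)) B"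
  proof (rule interpolating_tail_matching_moments[OF p _ _ _ _ S])
    show "T s \<in> borel_measurable borel" for s unfolding T_def by measurable
    show "0 < T s u" if "s \<in> {0..1}" "0 < u" "u < 1" for s u
    proof -
      have "(1 - s) * u \<le> 1 * u" using that by (intro mult_right_mono) auto
      with that have "(1 - s) * u < 1" by linarith
      then show ?thesis by (simp add: T_def)
    qed
    \<comment> \<open>Below the cutoff, \<open>- s * u = (1 - s) * u - u < 1 - u\<close>.\<close>
    show "0 \<le> T s u \<and> T s u \<le> exp (1 - u)" if "s \<in> {0..1}" "0 < u" for s u
      by (auto simp: T_def algebra_simps)
    show "\<exists>c. \<forall>u>0. u \<noteq> c \<longrightarrow> ((\<lambda>k. T k u) \<longlongrightarrow> T s u) (at s within {0..1})" if s: "s \<in> {0..1}" for s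
    \<comment> \<open>The exceptional point is the jump of \<open>T s\<close>. For
      \<open>s = 1\<close> there is no jump, and the expression evaluates to 0, which
      \<open>u > 0\<close> avoids.\<close>
    proof (intro exI[of _ "1 / (1 - s)"] allI impI)
      fix u :: real assume u: "0 < u" "u \<noteq> 1 / (1 - s)"
      have lim: "((\<lambda>k. (1 - k) * u) \<longlongrightarrow> (1 - s) * u) (at s within {0..1})"
        by (intro tendsto_intros)
      have "(1 - s) * u \<noteq> 1"
      proof
        assume e: "(1 - s) * u = 1"
        then have "1 - s \<noteq> 0" by auto
        with e u(2) show False by (simp add: eq_divide_eq mult.commute)
      qed
      then have "(1 - s) * u < 1 \<or> (1 - s) * u > 1" by auto
      then have "\<forall>\<^sub>F k in at s within {0..1}. ((1 - k) * u < 1) = ((1 - s) * u < 1)"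
      proof
        assume "(1 - s) * u < 1"
        with order_tendstoD(2)[OF lim this] show ?thesis by (auto elim: eventually_mono)
      next
        assume "(1 - s) * u > 1"
        with order_tendstoD(1)[OF lim this] show ?thesis by (auto elim: eventually_mono)
      qed
      then have "\<forall>\<^sub>F k in at s within {0..1}. exp (- k * u) * (if (1 - s) * u < 1 then 1 else 0) = T k u"
        by eventually_elim (simp add: T_def)
      moreover have "((\<lambda>k. exp (- k * u) * (if (1 - s) * u < 1 then 1 else 0)) \<longlongrightarrow> T s u) (at s within {0..1})"
        unfolding T_def by (intro tendsto_intros)
      ultimately show "((\<lambda>k. T k u) \<longlongrightarrow> T s u) (at s within {0..1})"
        by (rule Lim_transform_eventually[rotated])
    qed
    show "crosses_up (tail \<mu>) (\<lambda>u. T 0 (u / \<kappa>))" if "\<kappa> > 0" for \<kappa>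
      unfolding crosses_up_def
    proof (intro allI impI)
      fix u v assume *: "0 < u \<and> u < v \<and> T 0 (u / \<kappa>) < tail \<mu> u"
      then have "\<kappa> \<le> u" using tb(2)[of u] that by (auto simp: T_def split: if_splits)
      then show "T 0 (v / \<kappa>) \<le> tail \<mu> v" using * that tb(1) by (auto simp: T_def)
    qed
    show "crosses_up (\<lambda>u. T 1 (u / \<kappa>)) (tail \<mu>)" if \<kappa>: "\<kappa> > 0" for \<kappa>
      unfolding crosses_up_def
    proof (intro allI impI)
      fix u v assume *: "0 < u \<and> u < v \<and> tail \<mu> u < T 1 (u / \<kappa>)"
      have "tail \<mu> v < exp (- (1 / \<kappa>) * v)"
        by (rule log_concave_tail_below_exp[OF lc S0 tb(1), where u = u]) (use * in \<open>auto simp: T_def\<close>)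
      then show "tail \<mu> v \<le> T 1 (v / \<kappa>)" by (simp add: T_def)
    qed
  qed
  then obtain s \<kappa> where s: "0 \<le> s" "s \<le> 1" and \<kappa>: "\<kappa> > 0"
    and m: "has_tail_moment 2 (\<lambda>u. T s (u / \<kappa>)) A" "has_tail_moment p (\<lambda>u. T s (u / \<kappa>)) B" by auto
  define a where "a = s / \<kappa>"
  have a: "a \<ge> 0" using s \<kappa> by (simp add: a_def)
  have log: "r < exp (- a * t) \<longleftrightarrow> a * t < - ln r" if "0 < r" for r t
    using that by (metis exp_less_cancel_iff exp_ln less_minus_iff mult_minus_left)
  have "\<exists>\<nu>\<in>G_plus. \<forall>t\<ge>0. tail \<nu> t = T s (t / \<kappa>)"
  proof (cases "s = 1")
    case True
    then have a0: "a > 0" using \<kappa> by (simp add: a_def)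
    have "\<exists>\<nu>. symmetric_law \<nu> \<and> (\<forall>t\<ge>0. tail \<nu> t = exp (- a * t))"
    proof (rule symmetric_law_with_tail[of "\<lambda>r. - ln r / a"])
      show "t < - ln r / a \<longleftrightarrow> r < exp (- a * t)" if "t \<ge> 0" "0 < r" "r < 1" for t r
        unfolding log[OF that(2)] using a0 by (simp add: field_simps)
    qed (use a in auto)
    then obtain \<nu> where \<nu>: "symmetric_law \<nu>" "\<forall>t\<ge>0. tail \<nu> t = exp (- a * t)" by blast
    then have "\<nu> \<in> G_plus" using a by (auto simp: G_plus_def intro!: exI[of _ a])
    with \<nu>(2) show ?thesis using True by (intro bexI[of _ \<nu>]) (auto simp: T_def a_def)
  next
    case False
    define b where "b = \<kappa> / (1 - s)"
    have b: "b > 0" using s False \<kappa> by (simp add: b_def)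
    have "\<exists>\<nu>. symmetric_law \<nu> \<and> (\<forall>t\<ge>0. tail \<nu> t = exp (- a * t) * indicator {0..<b} t)"
    \<comment> \<open>For \<open>a = 0\<close> the inverse is the cutoff alone; the quotient
      \<open>- ln r / a\<close> would evaluate to 0 there instead of infinity.\<close>
    proof (rule symmetric_law_with_tail[of "\<lambda>r. if a = 0 then b else min b (- ln r / a)"])
      fix t r :: real assume tr: "t \<ge> 0" "0 < r" "r < 1"
      show "t < (if a = 0 then b else min b (- ln r / a)) \<longleftrightarrow> r < exp (- a * t) * indicator {0..<b} t"
      proof (cases "t < b")
        case True
        then have "r < exp (- a * t) * indicator {0..<b} t \<longleftrightarrow> a * t < - ln r"
          using log[OF tr(2), of t] tr by simp
        then show ?thesis using True a tr by (auto simp: field_simps)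
      qed (use tr in auto)
    qed (use a in \<open>auto simp: indicator_def\<close>)
    then obtain \<nu> where \<nu>: "symmetric_law \<nu>" "\<forall>t\<ge>0. tail \<nu> t = exp (- a * t) * indicator {0..<b} t" by blast
    then have "\<nu> \<in> G_plus" using a b unfolding G_plus_def by (blast intro: less_imp_le)
    moreover have "(1 - s) * (t / \<kappa>) < 1 \<longleftrightarrow> t < b" for t
      using s False \<kappa> by (simp add: b_def field_simps)
    ultimately show ?thesis using \<nu>(2) by (intro bexI[of _ \<nu>]) (auto simp: T_def a_def indicator_def)
  qed
  then obtain \<nu> where \<nu>: "\<nu> \<in> G_plus" "\<And>t. t \<ge> 0 \<Longrightarrow> tail \<nu> t = T s (t / \<kappa>)" by blast
  have eq: "(\<lambda>u. indicator {0<..} u * (u powr (q - 1) * T s (u / \<kappa>))) = (\<lambda>u. indicator {0<..} u * (u powr (q - 1) * tail \<nu> u))" for q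
    using \<nu>(2) by (auto simp: indicator_def)
  show ?thesis using \<nu>(1) m unfolding has_tail_moment_def eq by blast
qed

subsection \<open>The extremal classes\<close>

text \<open>The tail that leaves the value 1 first, at \<open>b1 \<le> b2\<close>, crosses up over
  the other. It can be strictly larger only from \<open>b2\<close> on. There the other tail is
  either 0 already or decays at a rate \<open>a2 > a1\<close>, so the lead persists.\<close>

lemma G_minus_crosses_up:
  assumes "\<mu> \<in> G_minus" "\<nu> \<in> G_minus"
  shows "crosses_up (tail \<mu>) (tail \<nu>) \<or> crosses_up (tail \<nu>) (tail \<mu>)"
proof -
  define F where "F = (\<lambda>b T. (\<exists>a\<ge>0. \<forall>t\<ge>0. T t = exp (- a * max (t - b) 0)) \<or>
     (\<forall>t\<ge>0::real. T t = (indicator {0..<b} t :: real)))"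
  have cr: "crosses_up T1 T2" if F1: "F b1 T1" and F2: "F b2 T2" and b: "b1 \<le> b2" for b1 b2 T1 T2
    unfolding crosses_up_def
  proof (intro allI impI)
    fix u v assume *: "0 < u \<and> u < v \<and> T2 u < T1 u"
    have nonneg: "0 \<le> T1 v" "T1 u \<le> 1"
      using F1 * by (auto simp: F_def indicator_def)
    consider (ind) "\<forall>t\<ge>0. T2 t = indicator {0..<b2} t" | (exp) a2 where "a2 \<ge> 0" "\<forall>t\<ge>0. T2 t = exp (- a2 * max (t - b2) 0)"
      using F2 by (auto simp: F_def)
    then show "T2 v \<le> T1 v"
    proof cases
      case ind
      have "b2 \<le> u"
      proof (rule ccontr)
        assume "\<not> b2 \<le> u"
        then have "T2 u = 1" using ind * by simp
        then show False using * nonneg by simp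
      qed
      then show ?thesis using ind nonneg * by (simp add: indicator_def)
    next
      case exp
      then have u: "b2 < u" using * nonneg by (cases "u \<le> b2") auto
      from F1 show ?thesis unfolding F_def
      proof
        assume "\<forall>t\<ge>0. T1 t = indicator {0..<b1} t"
        then have "T1 u = 0" using u b * by (simp add: indicator_def)
        moreover have "T2 u > 0" using exp * by simp
        ultimately show ?thesis using * by simp
      next
        assume "\<exists>a\<ge>0. \<forall>t\<ge>0. T1 t = exp (- a * max (t - b1) 0)"
        then obtain a1 where a1: "a1 \<ge> 0" "\<forall>t\<ge>0. T1 t = exp (- a1 * max (t - b1) 0)" by blast
        have T: "T1 t = exp (- (a1 * (t - b1)))" "T2 t = exp (- (a2 * (t - b2)))" if "u \<le> t" for t
          using that * a1(2) exp(2) u b by (simp_all add: max_absorb1)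
        have 1: "a1 * (u - b1) < a2 * (u - b2)" using * T[of u] by simp
        have "a1 * (u - b2) \<le> a1 * (u - b1)" using a1 b by (intro mult_left_mono) auto
        with 1 have "a1 * (u - b2) < a2 * (u - b2)" by simp
        then have "a1 < a2" using u by (simp add: mult_less_cancel_right)
        then have "a1 * (v - u) \<le> a2 * (v - u)" using * by (intro mult_right_mono) auto
        with 1 have "a1 * (v - b1) \<le> a2 * (v - b2)" by (simp add: algebra_simps)
        then show ?thesis using * T[of v] by simp
      qed
    qed
  qed
  obtain b1 b2 where F: "F b1 (tail \<mu>)" "F b2 (tail \<nu>)"
    using assms unfolding G_minus_def F_def by blast
  show ?thesis using cr[OF F] cr[OF F(2,1)] by (cases "b1 \<le> b2") auto
qed

text \<open>The set \<open>D\<close> treats finite and infinite cutoffs uniformly.\<close>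

lemma G_plusE:
  assumes "\<mu> \<in> G_plus"
  obtains a D where "a \<ge> 0" "D = {0..} \<or> (\<exists>b\<ge>0. D = {0..<b})" "\<And>t. t \<ge> 0 \<Longrightarrow> tail \<mu> t = exp (- a * t) * indicator D t"
  using assms unfolding G_plus_def
proof (clarify, elim disjE exE conjE)
  fix a assume "a \<ge> 0" "\<forall>t\<ge>0. tail \<mu> t = exp (- a * t)"
  then show thesis using that[of a "{0..}"] by simp
next
  fix a b assume "a \<ge> 0" "b \<ge> 0" "\<forall>t\<ge>0. tail \<mu> t = exp (- a * t) * indicator {0..<b} t"
  then show thesis using that[of a "{0..<b}"] by blast
qed

text \<open>The tail with the larger support crosses up over the other: on the smaller support,
  being ahead means having the smaller rate, and beyond it the other tail is 0.\<close>

lemma G_plus_crosses_up: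
  assumes "\<mu> \<in> G_plus" "\<nu> \<in> G_plus"
  shows "crosses_up (tail \<mu>) (tail \<nu>) \<or> crosses_up (tail \<nu>) (tail \<mu>)"
proof -
  have cr: "crosses_up T2 T1" if T: "\<And>t. t \<ge> 0 \<Longrightarrow> T1 t = exp (- a1 * t) * indicator D1 t" "\<And>t. t \<ge> 0 \<Longrightarrow> T2 t = exp (- a2 * t) * indicator D2 t"
    and down: "\<And>u v. 0 \<le> u \<Longrightarrow> u \<le> v \<Longrightarrow> v \<in> D1 \<Longrightarrow> u \<in> D1" and sub: "D1 \<subseteq> D2" for T1 T2 a1 a2 and D1 D2 :: "real set"
    unfolding crosses_up_def
  proof (intro allI impI)
    fix u v :: real assume *: "0 < u \<and> u < v \<and> T1 u < T2 u"
    show "T1 v \<le> T2 v"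
    proof (cases "v \<in> D1")
      case True
      then have "u \<in> D1" using down[of u v] * by simp
      then have "a2 < a1" using * T sub by (auto simp: indicator_def)
      then show ?thesis using * T True sub by (auto simp: indicator_def)
    qed (use T * in \<open>auto simp: indicator_def\<close>)
  qed
  obtain a1 D1 where 1: "D1 = {0..} \<or> (\<exists>b\<ge>0. D1 = {0..<b})" "\<And>t. t \<ge> 0 \<Longrightarrow> tail \<mu> t = exp (- a1 * t) * indicator D1 t"
    using G_plusE[OF assms(1)] by metis
  obtain a2 D2 where 2: "D2 = {0..} \<or> (\<exists>b\<ge>0. D2 = {0..<b})" "\<And>t. t \<ge> 0 \<Longrightarrow> tail \<nu> t = exp (- a2 * t) * indicator D2 t"
    using G_plusE[OF assms(2)] by metis
  have down: "u \<in> D1" if "0 \<le> u" "u \<le> v" "v \<in> D1" for u v using 1(1) that by auto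
  have down': "u \<in> D2" if "0 \<le> u" "u \<le> v" "v \<in> D2" for u v using 2(1) that by auto
  have "D1 \<subseteq> D2 \<or> D2 \<subseteq> D1" using 1(1) 2(1) by (auto simp: subset_iff)
  then show ?thesis
  proof
    assume "D1 \<subseteq> D2"
    from cr[OF 1(2) 2(2) _ this] down show ?thesis by blast
  next
    assume "D2 \<subseteq> D1"
    from cr[OF 2(2) 1(2) _ this] down' show ?thesis by blast
  qed
qed

text \<open>Serves to exclude the point mass at 0, which both classes contain through
  \<open>b = 0\<close> although its tail at 0 is not 1.\<close>

lemma tail_moment_pos_imp_tail_not_zero:
  assumes "has_tail_moment q T m" "m > 0"
  shows "\<exists>t>0. T t \<noteq> 0"
proof (rule ccontr)
  assume "\<not> ?thesis"
  then have "(\<lambda>u. indicator {0<..} u * (u powr (q - 1) * T u)) = (\<lambda>_. 0)"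
    by (auto simp: indicator_def)
  then show False using assms by (simp add: has_tail_moment_def has_bochner_integral_iff)
qed

text \<open>Makes the extremal laws competitors in the optimisation. On the logarithmic scale the
  tail is the negative of a convex function, piecewise linear or infinite beyond
  \<open>b\<close>.\<close>

lemma G_minus_log_concave:
  assumes \<nu>: "\<nu> \<in> G_minus" and m: "has_tail_moment q (tail \<nu>) m" "m > 0"
  shows "\<nu> \<in> log_concave_tail_laws"
proof -
  obtain t0 where t0: "t0 > 0" "tail \<nu> t0 \<noteq> 0" using tail_moment_pos_imp_tail_not_zero[OF m] by blast
  have sym: "symmetric_law \<nu>" using \<nu> by (simp add: G_minus_def)
  from \<nu> consider (exp) a b where "a \<ge> 0" "b \<ge> 0" "\<forall>t\<ge>0. tail \<nu> t = exp (- a * max (t - b) 0)"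
    | (ind) b where "b \<ge> 0" "\<forall>t\<ge>0. tail \<nu> t = indicator {0..<b} t"
    by (auto simp: G_minus_def)
  then show ?thesis
  proof cases
    case exp
    have "log_concave_on_nonneg (tail \<nu>)"
      unfolding log_concave_on_nonneg_def
    proof (intro allI impI)
      fix s t l :: real assume st: "0 \<le> s" "0 \<le> t" and l: "0 < l \<and> l < 1"
      have "max ((1 - l) * s + l * t - b) 0 \<le> (1 - l) * max (s - b) 0 + l * max (t - b) 0"
      proof -
        have "(1 - l) * (s - b) \<le> (1 - l) * max (s - b) 0" "l * (t - b) \<le> l * max (t - b) 0"
          using l by (auto intro!: mult_left_mono)
        moreover have "0 \<le> (1 - l) * max (s - b) 0" "0 \<le> l * max (t - b) 0" using l by auto
        moreover have "(1 - l) * s + l * t - b = (1 - l) * (s - b) + l * (t - b)"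
          by (simp add: algebra_simps)
        ultimately show ?thesis by (intro max.boundedI) linarith+
      qed
      then have "a * max ((1 - l) * s + l * t - b) 0 \<le> a * ((1 - l) * max (s - b) 0 + l * max (t - b) 0)"
        using exp(1) by (rule mult_left_mono)
      moreover have "0 \<le> (1 - l) * s + l * t" using st l by simp
      ultimately show "tail \<nu> s powr (1 - l) * tail \<nu> t powr l \<le> tail \<nu> ((1 - l) * s + l * t)"
        using exp(3) st by (simp add: powr_def algebra_simps flip: exp_add)
    qed
    then show ?thesis using sym exp by (simp add: log_concave_tail_laws_def)
  next
    case ind
    have "b > 0" using ind t0 by (auto simp: indicator_def split: if_splits)
    have "log_concave_on_nonneg (tail \<nu>)"
      unfolding log_concave_on_nonneg_def
    proof (intro allI impI)
      fix s t l :: real assume st: "0 \<le> s" "0 \<le> t" and l: "0 < l \<and> l < 1"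
      have 0: "0 \<le> (1 - l) * s + l * t" using st l by simp
      show "tail \<nu> s powr (1 - l) * tail \<nu> t powr l \<le> tail \<nu> ((1 - l) * s + l * t)"
      proof (cases "s < b \<and> t < b")
        case True
        then have "(1 - l) * s + l * t < b" using l by (intro convex_bound_lt) auto
        then show ?thesis using ind st 0 True by simp
      qed (use ind st 0 in \<open>auto simp: indicator_def\<close>)
    qed
    then show ?thesis using sym ind \<open>b > 0\<close> by (simp add: log_concave_tail_laws_def)
  qed
qed

lemma G_plus_log_concave:
  assumes \<nu>: "\<nu> \<in> G_plus" and m: "has_tail_moment q (tail \<nu>) m" "m > 0"
  shows "\<nu> \<in> log_concave_tail_laws"
proof -
  obtain t0 where t0: "t0 > 0" "tail \<nu> t0 \<noteq> 0" using tail_moment_pos_imp_tail_not_zero[OF m] by blast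
  have sym: "symmetric_law \<nu>" using \<nu> by (simp add: G_plus_def)
  obtain a D where a: "a \<ge> 0" and D: "D = {0..} \<or> (\<exists>b\<ge>0. D = {0..<b})"
    and T: "\<And>t. t \<ge> 0 \<Longrightarrow> tail \<nu> t = exp (- a * t) * indicator D t"
    using G_plusE[OF \<nu>] by metis
  have 0: "0 \<in> D" using D t0 T[of t0] by (auto simp: indicator_def split: if_splits)
  have cvx: "(1 - l) * s + l * t \<in> D" if "s \<in> D" "t \<in> D" "0 < l" "l < 1" for s t l
  proof -
    have "(1 - l) * s + l * t \<ge> 0" using that D by auto
    moreover have "(1 - l) * s + l * t < b" if "s < b" "t < b" for b
      using that \<open>0 < l\<close> \<open>l < 1\<close> by (intro convex_bound_lt) auto
    ultimately show ?thesis using D that by auto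
  qed
  have "log_concave_on_nonneg (tail \<nu>)"
    unfolding log_concave_on_nonneg_def
  proof (intro allI impI)
    fix s t l :: real assume st: "0 \<le> s" "0 \<le> t" and l: "0 < l \<and> l < 1"
    have 0: "0 \<le> (1 - l) * s + l * t" using st l by simp
    show "tail \<nu> s powr (1 - l) * tail \<nu> t powr l \<le> tail \<nu> ((1 - l) * s + l * t)"
    proof (cases "s \<in> D \<and> t \<in> D")
      case True
      then have "(1 - l) * s + l * t \<in> D" using cvx l by blast
      then have "tail \<nu> ((1 - l) * s + l * t) = exp (- a * ((1 - l) * s + l * t))" using T[OF 0] by simp
      moreover have "tail \<nu> s = exp (- a * s)" "tail \<nu> t = exp (- a * t)"
        using T[OF st(1)] T[OF st(2)] True by auto
      ultimately show ?thesis by (simp add: powr_def algebra_simps flip: exp_add)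
    qed (use T[OF st(1)] T[OF st(2)] T[OF 0] in \<open>auto simp: indicator_def\<close>)
  qed
  then show ?thesis using sym T[of 0] 0 by (simp add: log_concave_tail_laws_def)
qed

text \<open>Where the tail of \<open>\<nu>\<close> is exceeded it is below 1, so \<open>u\<close>
  lies beyond its constant part. From there on it is log-affine or 0, hence at \<open>v\<close> it
  is at most the geometric interpolation of its values at \<open>u\<close> and \<open>w\<close>,
  while the log-concave tail of \<open>\<mu>\<close> is at least its own.\<close>

lemma exceeds_G_minus:
  assumes \<mu>: "\<mu> \<in> log_concave_tail_laws" and \<nu>: "\<nu> \<in> G_minus"
  shows "exceeds_on_interval (tail \<mu>) (tail \<nu>)"
  unfolding exceeds_on_interval_def
proof (intro allI impI, elim conjE)
  fix u v w :: real
  assume uvw: "0 < u" "u < v" "v < w" and less: "tail \<nu> u < tail \<mu> u" "tail \<nu> w < tail \<mu> w"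
  have rd: "real_distribution \<mu>" and lc: "log_concave_on_nonneg (tail \<mu>)"
    using \<mu> by (auto simp: log_concave_tail_laws_def symmetric_law_def)
  have rd': "real_distribution \<nu>" using \<nu> by (auto simp: G_minus_def symmetric_law_def)
  note tb = tail_bounds[OF rd]
  define l where "l = (v - u) / (w - u)"
  have l: "0 < l" "l < 1" using uvw by (auto simp: l_def)
  have v: "(1 - l) * u + l * w = v"
  proof -
    have "l * (w - u) = v - u" using uvw by (simp add: l_def)
    then show ?thesis by (simp add: algebra_simps)
  qed
  have "tail \<nu> v \<le> tail \<nu> u powr (1 - l) * tail \<nu> w powr l"
  proof -
    from \<nu> consider (exp) a b where "a \<ge> 0" "b \<ge> 0" "\<forall>t\<ge>0. tail \<nu> t = exp (- a * max (t - b) 0)"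
      | (ind) b where "b \<ge> 0" "\<forall>t\<ge>0. tail \<nu> t = indicator {0..<b} t"
      by (auto simp: G_minus_def)
    then show ?thesis
    proof cases
      case exp
      have "b < u" using exp less(1) tb(2)[of u] uvw by (cases "u \<le> b") auto
      then have "a * (v - b) = (1 - l) * (a * (u - b)) + l * (a * (w - b))"
        unfolding v[symmetric] by (simp add: algebra_simps)
      then show ?thesis using exp(3) uvw \<open>b < u\<close>
        by (simp add: powr_def max_def flip: exp_add)
    next
      case ind
      have "b \<le> u" using ind less(1) tb(2)[of u] uvw by (cases "u < b") auto
      then show ?thesis using ind uvw by simp
    qed
  qed
  also have "\<dots> \<le> tail \<mu> u powr (1 - l) * tail \<mu> w powr l"
    using l less tail_bounds[OF rd'] by (intro mult_mono powr_mono2) auto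
  also have "\<dots> \<le> tail \<mu> v"
    using lc l uvw unfolding log_concave_on_nonneg_def v[symmetric] by auto
  finally show "tail \<nu> v \<le> tail \<mu> v" .
qed

text \<open>The excess at \<open>w\<close> puts \<open>w\<close>, and hence all earlier points,
  inside the support, where the tail of \<open>\<nu>\<close> is a pure exponential. Once the tail of
  \<open>\<mu>\<close> lies below that exponential it stays below.\<close>

lemma exceeds_G_plus:
  assumes \<mu>: "\<mu> \<in> log_concave_tail_laws" and \<nu>: "\<nu> \<in> G_plus"
  shows "exceeds_on_interval (tail \<nu>) (tail \<mu>)"
  unfolding exceeds_on_interval_def
proof (intro allI impI, elim conjE)
  fix u v w :: real
  assume uvw: "0 < u" "u < v" "v < w" and less: "tail \<mu> u < tail \<nu> u" "tail \<mu> w < tail \<nu> w"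
  have rd: "real_distribution \<mu>" and lc: "log_concave_on_nonneg (tail \<mu>)" and S0: "tail \<mu> 0 = 1"
    using \<mu> by (auto simp: log_concave_tail_laws_def symmetric_law_def)
  note tb = tail_bounds[OF rd]
  obtain a D where D: "D = {0..} \<or> (\<exists>b\<ge>0. D = {0..<b})"
    and T: "\<And>t. t \<ge> 0 \<Longrightarrow> tail \<nu> t = exp (- a * t) * indicator D t"
    using G_plusE[OF \<nu>] by metis
  have "w \<in> D"
  proof (rule ccontr)
    assume "w \<notin> D"
    then have "tail \<nu> w = 0" using T[of w] uvw by simp
    then show False using less(2) tb(1)[of w] by simp
  qed
  then have "u \<in> D" "v \<in> D" using D uvw by auto
  then have eq: "tail \<nu> u = exp (- a * u)" "tail \<nu> v = exp (- a * v)" using T uvw by auto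
  have "tail \<mu> v < exp (- a * v)"
    by (rule log_concave_tail_below_exp[OF lc S0 tb(1), where u = u]) (use less(1) uvw eq in auto)
  then show "tail \<mu> v \<le> tail \<nu> v" using eq by simp
qed

section \<open>Reduction to product laws and solution of the extremal problem\<close>

lemma moment_laws_iff_has_tail_moment:
  assumes "symmetric_law \<mu>" "p > 1"
  shows "\<mu> \<in> moment_laws p \<alpha> \<beta> \<longleftrightarrow>
    has_tail_moment 2 (tail \<mu>) (\<alpha>\<^sup>2 / 2) \<and> has_tail_moment p (tail \<mu>) (\<beta> powr p / p)"
proof -
  have rd: "real_distribution \<mu>" using assms by (simp add: symmetric_law_def)
  have "x\<^sup>2 = \<bar>x\<bar> powr 2" for x :: real by (cases "x = 0") auto
  then show ?thesis
    unfolding moment_laws_def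
    using nn_integral_powr_eq_iff_has_tail_moment[OF rd, of 2 "\<alpha>\<^sup>2"]
      nn_integral_powr_eq_iff_has_tail_moment[OF rd assms(2), of "\<beta> powr p"] by simp
qed

lemma sum_moment_eq_PiM:
  assumes "independent_with_laws_in M X n L" "n \<ge> 1"
  shows "sum_moment p n M X = (\<integral>\<^sup>+x. ennreal (\<bar>0 + (\<Sum>j\<in>{1..n}. x j)\<bar> powr p) \<partial>PiM {1..n} (\<lambda>j. distr M borel (X j)))"
proof -
  interpret prob_space M using assms(1) by (simp add: independent_with_laws_in_def)
  have iv: "indep_vars (\<lambda>_. borel) X {1..n}" using assms(1) by (simp add: independent_with_laws_in_def)
  then have rv: "X i \<in> borel_measurable M" if "i \<in> {1..n}" for i using that by (simp add: indep_vars_def2)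
  define P where "P = (\<Pi>\<^sub>M i\<in>{1..n}. (borel :: real measure))"
  define Y where "Y = (\<lambda>\<omega>. \<lambda>i\<in>{1..n}. X i \<omega>)"
  have Y: "Y \<in> measurable M P" unfolding Y_def P_def by (intro measurable_restrict rv)
  have D: "distr M P Y = PiM {1..n} (\<lambda>j. distr M borel (X j))"
    using iv indep_vars_iff_distr_eq_PiM'[of "{1..n}" X "\<lambda>_. borel"] rv assms(2)
    unfolding P_def Y_def by simp
  have "(\<lambda>f. f i) \<in> borel_measurable P" if "i \<in> {1..n}" for i
    unfolding P_def using that by (rule measurable_component_singleton)
  then have [measurable]: "(\<lambda>f. \<Sum>j\<in>{1..n}. f j) \<in> borel_measurable P" by (intro borel_measurable_sum)
  have "(\<lambda>f. ennreal (\<bar>0 + (\<Sum>j\<in>{1..n}. f j)\<bar> powr p)) \<in> borel_measurable P" by measurable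
  then show ?thesis
    unfolding D[symmetric] sum_moment_def
    by (subst nn_integral_distr[OF Y]) (auto simp: Y_def intro!: nn_integral_cong)
qed

lemma sum_moment_mono:
  assumes X: "independent_with_laws_in M X n L" and Y: "independent_with_laws_in N Y n L'" and n: "n \<ge> 1"
    and le: "\<And>j \<mu> \<nu> z. j \<in> {1..n} \<Longrightarrow> \<mu> \<in> L j \<Longrightarrow> \<nu> \<in> L' j \<Longrightarrow>
      (\<integral>\<^sup>+x. ennreal (\<bar>z + x\<bar> powr p) \<partial>\<mu>) \<le> (\<integral>\<^sup>+x. ennreal (\<bar>z + x\<bar> powr p) \<partial>\<nu>)"
  shows "sum_moment p n M X \<le> sum_moment p n N Y"
proof -
  \<comment> \<open>Outside \<open>{1..n}\<close> the point mass at 0 fills in, since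
    \<open>PiM_shifted_moment_mono\<close> asks for a distribution at every index; the product over
    \<open>{1..n}\<close> does not see it.\<close>
  define \<mu> where "\<mu> = (\<lambda>j. if j \<in> {1..n} then distr M borel (X j) else return borel 0)"
  define \<nu> where "\<nu> = (\<lambda>j. if j \<in> {1..n} then distr N borel (Y j) else return borel 0)"
  have rd: "real_distribution (if j \<in> {1..n} then distr M' borel (X' j) else return borel 0)"
    if "independent_with_laws_in M' X' n L''" for M' :: "'c measure" and X' L'' j
  proof -
    interpret prob_space M' using that by (simp add: independent_with_laws_in_def)
    have "indep_vars (\<lambda>_. borel) X' {1..n}" using that by (simp add: independent_with_laws_in_def)
    then have "X' i \<in> borel_measurable M'" if "i \<in> {1..n}" for i using that by (simp add: indep_vars_def2)
    moreover have "real_distribution (return borel (0 :: real))"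
      by (simp add: real_distribution_def real_distribution_axioms_def prob_space_return)
    ultimately show ?thesis by (simp add: real_distribution_distr)
  qed
  have "(\<integral>\<^sup>+x. ennreal (\<bar>0 + (\<Sum>i\<in>{1..n}. x i)\<bar> powr p) \<partial>PiM {1..n} \<mu>)
     \<le> (\<integral>\<^sup>+x. ennreal (\<bar>0 + (\<Sum>i\<in>{1..n}. x i)\<bar> powr p) \<partial>PiM {1..n} \<nu>)"
  proof (rule PiM_shifted_moment_mono)
    show "real_distribution (\<mu> i)" "real_distribution (\<nu> i)" for i
      unfolding \<mu>_def \<nu>_def using rd[OF X] rd[OF Y] by blast+
    show "(\<integral>\<^sup>+x. ennreal (\<bar>z + x\<bar> powr p) \<partial>\<mu> i) \<le> (\<integral>\<^sup>+x. ennreal (\<bar>z + x\<bar> powr p) \<partial>\<nu> i)"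
      if i: "i \<in> {1..n}" for i z
    proof -
      have "distr M borel (X i) \<in> L i" "distr N borel (Y i) \<in> L' i"
        using X Y i by (auto simp: independent_with_laws_in_def)
      from le[OF i this, of z] show ?thesis using i by (simp add: \<mu>_def \<nu>_def)
    qed
  qed simp
  moreover have "PiM {1..n} \<mu> = PiM {1..n} (\<lambda>j. distr M borel (X j))" "PiM {1..n} \<nu> = PiM {1..n} (\<lambda>j. distr N borel (Y j))"
    by (auto intro!: PiM_cong simp: \<mu>_def \<nu>_def)
  ultimately show ?thesis
    unfolding sum_moment_eq_PiM[OF X n] sum_moment_eq_PiM[OF Y n] by simp
qed

theorem theorem7:
  fixes p :: real and n :: nat and a b :: "nat \<Rightarrow> real"
  assumes "p > 4" and "n \<ge> 1"
    and "\<forall>j\<in>{1..n}. a j > 0 \<and> b j > 0"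
    and feasible: "\<forall>j\<in>{1..n}. \<exists>\<mu>. \<mu> \<in> log_concave_tail_laws \<inter> moment_laws p (a j) (b j)"
  shows "(\<forall>j\<in>{1..n}. \<exists>!\<mu>. \<mu> \<in> G_minus \<inter> moment_laws p (a j) (b j)) \<and>
    (\<forall>j\<in>{1..n}. \<exists>!\<mu>. \<mu> \<in> G_plus \<inter> moment_laws p (a j) (b j)) \<and>
    (\<forall>(M :: 'w measure) Xm.
       independent_with_laws_in M Xm n (\<lambda>j. G_minus \<inter> moment_laws p (a j) (b j)) \<longrightarrow>
       Inf (sum_moment_values p n a b) = sum_moment p n M Xm) \<and>
    (\<forall>(M :: 'v measure) Xp.
       independent_with_laws_in M Xp n (\<lambda>j. G_plus \<inter> moment_laws p (a j) (b j)) \<longrightarrow>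
       Sup (sum_moment_values p n a b) = sum_moment p n M Xp)"
proof -
  define mom where "mom = (\<lambda>j \<mu>. has_tail_moment 2 (tail \<mu>) ((a j)\<^sup>2 / 2) \<and> has_tail_moment p (tail \<mu>) (b j powr p / p))"
  have mom: "\<mu> \<in> moment_laws p (a j) (b j) \<longleftrightarrow> mom j \<mu>" if "symmetric_law \<mu>" for \<mu> j
    using moment_laws_iff_has_tail_moment[OF that, of p "a j" "b j"] assms(1) by (simp add: mom_def)
  have symL: "symmetric_law \<mu>" if "\<mu> \<in> log_concave_tail_laws" for \<mu> using that by (simp add: log_concave_tail_laws_def)
  have symm: "symmetric_law \<mu>" if "\<mu> \<in> G_minus" for \<mu> using that by (simp add: G_minus_def)
  have symp: "symmetric_law \<mu>" if "\<mu> \<in> G_plus" for \<mu> using that by (simp add: G_plus_def)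
  have apos: "(a j)\<^sup>2 / 2 > 0" if "j \<in> {1..n}" for j
  proof -
    have "a j > 0" using assms(3) that by blast
    then show ?thesis by simp
  qed
  have p2: "p > 2" using assms(1) by simp
  \<comment> \<open>Two members of one class cross at most once, in one direction or the other, so
    equal second and \<open>p\<close>-th moments identify them.\<close>
  have uniq: "\<mu> = \<nu>" if "symmetric_law \<mu>" "symmetric_law \<nu>" "mom j \<mu>" "mom j \<nu>"
    "crosses_up (tail \<mu>) (tail \<nu>) \<or> crosses_up (tail \<nu>) (tail \<mu>)" for \<mu> \<nu> j
    using that symmetric_law_eq_of_crosses_up[OF _ _ p2, of \<mu> \<nu>] symmetric_law_eq_of_crosses_up[OF _ _ p2, of \<nu> \<mu>]
    unfolding mom_def by blast
  have "\<exists>!\<mu>. \<mu> \<in> G_minus \<inter> moment_laws p (a j) (b j)" if j: "j \<in> {1..n}" for j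
  proof (rule ex_ex1I)
    obtain \<mu> where "\<mu> \<in> log_concave_tail_laws" "mom j \<mu>" using feasible j symL mom by blast
    then obtain \<nu> where "\<nu> \<in> G_minus" "mom j \<nu>"
      using G_minus_matching_moments[OF p2 _ _ _ apos[OF j]] unfolding mom_def by blast
    then show "\<exists>\<nu>. \<nu> \<in> G_minus \<inter> moment_laws p (a j) (b j)" using symm mom by blast
  next
    fix \<mu> \<nu> assume "\<mu> \<in> G_minus \<inter> moment_laws p (a j) (b j)" "\<nu> \<in> G_minus \<inter> moment_laws p (a j) (b j)"
    then show "\<mu> = \<nu>" using uniq[of \<mu> \<nu> j] symm mom G_minus_crosses_up by blast
  qed
  moreover have "\<exists>!\<mu>. \<mu> \<in> G_plus \<inter> moment_laws p (a j) (b j)" if j: "j \<in> {1..n}" for j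
  proof (rule ex_ex1I)
    obtain \<mu> where "\<mu> \<in> log_concave_tail_laws" "mom j \<mu>" using feasible j symL mom by blast
    then obtain \<nu> where "\<nu> \<in> G_plus" "mom j \<nu>"
      using G_plus_matching_moments[OF p2 _ _ _ apos[OF j]] unfolding mom_def by blast
    then show "\<exists>\<nu>. \<nu> \<in> G_plus \<inter> moment_laws p (a j) (b j)" using symp mom by blast
  next
    fix \<mu> \<nu> assume "\<mu> \<in> G_plus \<inter> moment_laws p (a j) (b j)" "\<nu> \<in> G_plus \<inter> moment_laws p (a j) (b j)"
    then show "\<mu> = \<nu>" using uniq[of \<mu> \<nu> j] symp mom G_plus_crosses_up by blast
  qed
  moreover have "Inf (sum_moment_values p n a b) = sum_moment p n M Xm"
    if ind: "independent_with_laws_in M Xm n (\<lambda>j. G_minus \<inter> moment_laws p (a j) (b j))"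
    for M :: "'w measure" and Xm
  proof (rule antisym)
    \<comment> \<open>The extremal sequence is itself admissible, which bounds the infimum from
      above; the comparison of shifted moments gives the other bound.\<close>
    have "\<nu> \<in> log_concave_tail_laws" if "\<nu> \<in> G_minus \<inter> moment_laws p (a j) (b j)" "j \<in> {1..n}" for \<nu> j
      using that G_minus_log_concave[OF _ _ apos] symm mom unfolding mom_def by blast
    then have "independent_with_laws_in M Xm n (\<lambda>j. log_concave_tail_laws \<inter> moment_laws p (a j) (b j))"
      using ind unfolding independent_with_laws_in_def by blast
    from sum_moment_in_values[OF assms(2) this]
    show "Inf (sum_moment_values p n a b) \<le> sum_moment p n M Xm" by (rule Inf_lower)
    show "sum_moment p n M Xm \<le> Inf (sum_moment_values p n a b)"
    proof (rule Inf_greatest)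
      fix y assume "y \<in> sum_moment_values p n a b"
      then obtain N :: "(nat \<Rightarrow> real) measure" and X where y: "y = sum_moment p n N X"
        and X: "independent_with_laws_in N X n (\<lambda>j. log_concave_tail_laws \<inter> moment_laws p (a j) (b j))"
        unfolding sum_moment_values_def by blast
      show "sum_moment p n M Xm \<le> y" unfolding y
      proof (rule sum_moment_mono[OF ind X assms(2)])
        fix j \<mu> \<nu> z assume "\<nu> \<in> G_minus \<inter> moment_laws p (a j) (b j)" "\<mu> \<in> log_concave_tail_laws \<inter> moment_laws p (a j) (b j)"
        then show "(\<integral>\<^sup>+x. ennreal (\<bar>z + x\<bar> powr p) \<partial>\<nu>) \<le> (\<integral>\<^sup>+x. ennreal (\<bar>z + x\<bar> powr p) \<partial>\<mu>)"
          using shifted_moment_mono[OF assms(1), of \<mu> \<nu>] exceeds_G_minus symm symL mom unfolding mom_def by blast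
      qed
    qed
  qed
  moreover have "Sup (sum_moment_values p n a b) = sum_moment p n M Xp"
    if ind: "independent_with_laws_in M Xp n (\<lambda>j. G_plus \<inter> moment_laws p (a j) (b j))"
    for M :: "'v measure" and Xp
  proof (rule antisym)
    have "\<nu> \<in> log_concave_tail_laws" if "\<nu> \<in> G_plus \<inter> moment_laws p (a j) (b j)" "j \<in> {1..n}" for \<nu> j
      using that G_plus_log_concave[OF _ _ apos] symp mom unfolding mom_def by blast
    then have "independent_with_laws_in M Xp n (\<lambda>j. log_concave_tail_laws \<inter> moment_laws p (a j) (b j))"
      using ind unfolding independent_with_laws_in_def by blast
    from sum_moment_in_values[OF assms(2) this]
    show "sum_moment p n M Xp \<le> Sup (sum_moment_values p n a b)" by (rule Sup_upper)
    show "Sup (sum_moment_values p n a b) \<le> sum_moment p n M Xp"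
    proof (rule Sup_least)
      fix y assume "y \<in> sum_moment_values p n a b"
      then obtain N :: "(nat \<Rightarrow> real) measure" and X where y: "y = sum_moment p n N X"
        and X: "independent_with_laws_in N X n (\<lambda>j. log_concave_tail_laws \<inter> moment_laws p (a j) (b j))"
        unfolding sum_moment_values_def by blast
      show "y \<le> sum_moment p n M Xp" unfolding y
      \<comment> \<open>The roles are reversed relative to the infimum: here the extremal tail is
        the one that exceeds on an interval.\<close>
      proof (rule sum_moment_mono[OF X ind assms(2)])
        fix j \<mu> \<nu> z assume "\<mu> \<in> log_concave_tail_laws \<inter> moment_laws p (a j) (b j)" "\<nu> \<in> G_plus \<inter> moment_laws p (a j) (b j)"
        then show "(\<integral>\<^sup>+x. ennreal (\<bar>z + x\<bar> powr p) \<partial>\<mu>) \<le> (\<integral>\<^sup>+x. ennreal (\<bar>z + x\<bar> powr p) \<partial>\<nu>)"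
          using shifted_moment_mono[OF assms(1), of \<nu> \<mu>] exceeds_G_plus symp symL mom unfolding mom_def by blast
      qed
    qed
  qed
  ultimately show ?thesis by (intro conjI ballI allI impI)
qed

end
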